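(* Let $q$ be an odd prime power and write $q-1=\ell\cdot m$, where $\ell$ is an odd prime with $\ell\nmid m$. Let $\beta:\mathrm{GL}_2(q)\to \mathrm{GL}(V_{m,0})$ be the irreducible principal series representation $V_{m,0}$ described in the context. Call two subsets $S_1,S_2\subseteq \mathrm{GL}_2(q)$ cross-$1$-intersecting (with respect to $\beta$) if $\dim\{v\in V_{m,0}: \beta(g_1)v=\beta(g_2)v\}\ge 1$ for every $(g_1,g_2)\in S_1\times S_2$. Then $$\max_{(S_1,S_2)}\sqrt{|S_1|\cdot|S_2|}=\frac{|\mathrm{GL}_2(q)|}{\ell},$$ where the maximum is over all pairs $(S_1,S_2)$ of cross-$1$-intersecting subsets of $\mathrm{GL}_2(q)$.
   Context: $\mathrm{GL}_2(q)$ is the group of invertible $2\times 2$ matrices over the finite field $\mathbb{F}_q$. Fix a generator $\varepsilon$ of $\mathbb{F}_q^\times$ and let $\mu_m:\mathbb{F}_q^\times\to\mathbb{C}^\times$ be the character $\mu_m(\varepsilon^j)=\exp(2\pi\sqrt{-1}\, m j/(q-1))$. Then $V_{m,0}$ is the complex vector space of functions $f:\mathrm{GL}_2(q)\to\mathbb{C}$ satisfying $f\left(\begin{pmatrix}a&b\\0&d\end{pmatrix}x\right)=\mu_m(a)f(x)$ for all invertible upper triangular matrices and all $x\in\mathrm{GL}_2(q)$, with $\mathrm{GL}_2(q)$ acting by right translation: $(\beta(g)f)(x)=f(xg)$. *)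

theory Defs
  imports
    "HOL-Analysis.Analysis"
    "HOL-Computational_Algebra.Primes"
    "HOL-Library.Function_Algebras"
begin

text \<open>
  The field with \<open>q\<close> elements is a type \<open>'a :: {field, finite}\<close> with \<open>q = CARD('a)\<close>.
\<close>

definition GL2 :: "(('a::{field, finite})^2^2) set" where
  "GL2 = {A. invertible A}"

definition is_generator :: "'a::{field, finite} \<Rightarrow> bool" where
  "is_generator \<epsilon> \<longleftrightarrow> \<epsilon> \<noteq> 0 \<and> (\<forall>x. x \<noteq> 0 \<longrightarrow> (\<exists>j::nat. x = \<epsilon> ^ j))"

text \<open>
  The character \<open>\<mu>\<^sub>m\<close> of the multiplicative group determined by a generator \<open>\<epsilon>\<close>.  It is defined
  through the least exponent; lemma \<open>mult_char_power\<close> below shows that every exponent gives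
  the same value.
\<close>

definition mult_char :: "'a::{field, finite} \<Rightarrow> nat \<Rightarrow> 'a \<Rightarrow> complex" where
  "mult_char \<epsilon> m x =
     (let j = (LEAST j. x = \<epsilon> ^ j)
      in exp (2 * of_real pi * \<i> * of_nat m * of_nat j / (of_nat CARD('a) - 1)))"

lemma generator_power_eq:
  fixes \<epsilon> :: "'a::{field, finite}"
  assumes "is_generator \<epsilon>" and "j \<le> k" and "\<epsilon> ^ j = \<epsilon> ^ k"
  shows "(CARD('a) - 1) dvd (k - j)"
proof -
  have nz: "\<epsilon> \<noteq> 0" and gen: "\<And>x. x \<noteq> 0 \<Longrightarrow> \<exists>j::nat. x = \<epsilon> ^ j"
    using assms(1) by (auto simp: is_generator_def)
  define N where "N = CARD('a) - 1"
  have card: "card (UNIV - {0::'a}) = N"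
    by (simp add: N_def card_Diff_singleton)
  have kj: "\<epsilon> ^ (k - j) = 1"
    using assms(2,3) nz by (simp add: power_diff)
  have "\<exists>r>0. \<epsilon> ^ r = 1"
  proof -
    have "\<not> inj (\<lambda>i::nat. \<epsilon> ^ i)"
      using finite_imageD[of "\<lambda>i::nat. \<epsilon> ^ i" UNIV] by (auto simp: infinite_UNIV_nat)
    then obtain a b :: nat where "a < b" "\<epsilon> ^ a = \<epsilon> ^ b"
      unfolding inj_def by (metis linorder_neqE_nat)
    then show ?thesis using nz
      by (intro exI[of _ "b - a"]) (simp add: power_diff)
  qed
  define r where "r = (LEAST r. r > 0 \<and> \<epsilon> ^ r = 1)"
  have r: "r > 0" "\<epsilon> ^ r = 1"
    using LeastI_ex[OF \<open>\<exists>r>0. \<epsilon> ^ r = 1\<close>] by (auto simp: r_def)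
  have rmin: "r \<le> s" if "s > 0" "\<epsilon> ^ s = 1" for s
    unfolding r_def using that by (intro Least_le) auto
  have md: "\<epsilon> ^ i = \<epsilon> ^ (i mod r)" for i
  proof -
    have "\<epsilon> ^ i = \<epsilon> ^ (r * (i div r) + i mod r)" by simp
    also have "\<dots> = \<epsilon> ^ (i mod r)" by (simp only: power_add power_mult r(2)) simp
    finally show ?thesis .
  qed
  have "inj_on (\<lambda>i. \<epsilon> ^ i) {..<r}"
  proof (rule linorder_inj_onI')
    fix a b assume "a \<in> {..<r}" "b \<in> {..<r}" "a < b"
    show "\<epsilon> ^ a \<noteq> \<epsilon> ^ b"
    proof
      assume "\<epsilon> ^ a = \<epsilon> ^ b"
      then have "\<epsilon> ^ (b - a) = 1" using nz \<open>a < b\<close> by (simp add: power_diff)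
      then have "r \<le> b - a" using rmin \<open>a < b\<close> by simp
      then show False using \<open>b \<in> {..<r}\<close> \<open>a < b\<close> by simp
    qed
  qed
  moreover have "(\<lambda>i. \<epsilon> ^ i) ` {..<r} = UNIV - {0}"
  proof (intro equalityI subsetI)
    fix x assume "x \<in> UNIV - {0::'a}"
    then obtain i where "x = \<epsilon> ^ i" using gen by auto
    then show "x \<in> (\<lambda>i. \<epsilon> ^ i) ` {..<r}" using md[of i] r(1) by auto
  qed (use nz in auto)
  ultimately have "r = N" using card by (metis card_image card_lessThan)
  have "(k - j) mod r = 0"
  proof (rule ccontr)
    assume "(k - j) mod r \<noteq> 0"
    moreover have "\<epsilon> ^ ((k - j) mod r) = 1" using md[of "k - j"] kj by simp
    ultimately show False using rmin[of "(k - j) mod r"] r(1)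
      by (meson mod_less_divisor neq0_conv not_le)
  qed
  then show ?thesis using \<open>r = N\<close> by (auto simp: N_def)
qed

lemma mult_char_power:
  fixes \<epsilon> :: "'a::{field, finite}"
  assumes "is_generator \<epsilon>"
  shows "mult_char \<epsilon> m (\<epsilon> ^ j) =
           exp (2 * of_real pi * \<i> * of_nat m * of_nat j / (of_nat CARD('a) - 1))"
proof -
  define i where "i = (LEAST i. \<epsilon> ^ j = \<epsilon> ^ i)"
  have eq: "\<epsilon> ^ i = \<epsilon> ^ j" unfolding i_def by (rule sym, rule LeastI[of _ j]) simp
  have le: "i \<le> j" unfolding i_def by (rule Least_le) simp
  obtain t where "j - i = (CARD('a) - 1) * t"
    using generator_power_eq[OF assms le eq] by auto
  then have j: "j = i + (CARD('a) - 1) * t" using le by simp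
  have "card {0, 1::'a} \<le> CARD('a)" by (rule card_mono) auto
  then have c: "CARD('a) \<ge> 2" by simp
  then have cz: "(of_nat CARD('a) - 1 :: complex) \<noteq> 0"
    by (metis One_nat_def Suc_1 not_less_eq_eq of_nat_1 of_nat_eq_iff order_refl right_minus_eq)
  have "2 * of_real pi * \<i> * of_nat m * of_nat j / (of_nat CARD('a) - 1) =
        2 * of_real pi * \<i> * of_nat m * of_nat i / (of_nat CARD('a) - 1 :: complex)
          + 2 * of_int (int (m * t)) * of_real pi * \<i>"
    using c cz by (simp add: j of_nat_diff field_simps)
  moreover have "exp (2 * of_int (int (m * t)) * of_real pi * \<i>) = 1"
    using exp_integer_2pi[of "of_int (int (m * t))"] by (simp add: mult_ac)
  ultimately have "exp (2 * of_real pi * \<i> * of_nat m * of_nat j / (of_nat CARD('a) - 1)) =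
        exp (2 * of_real pi * \<i> * of_nat m * of_nat i / (of_nat CARD('a) - 1 :: complex))"
    by (simp only: exp_add mult_1_right)
  then show ?thesis unfolding mult_char_def Let_def i_def by simp
qed

text \<open>
  Complex-valued functions form a complex vector space under the pointwise operations.  For the
  functions on a finite type considered here, \<open>cfun.dim\<close> is the usual dimension.
\<close>

definition cfun_scale :: "complex \<Rightarrow> ('b \<Rightarrow> complex) \<Rightarrow> 'b \<Rightarrow> complex" where
  "cfun_scale c f = (\<lambda>x. c * f x)"

global_interpretation cfun: vector_space cfun_scale
  by unfold_locales (auto simp: cfun_scale_def fun_eq_iff algebra_simps)

text \<open>
  The space \<open>V\<^bsub>m,0\<^esub>\<close>.  A function on \<open>GL\<^sub>2(q)\<close> is represented by its extension by zero to all
  matrices.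
\<close>

definition principal_series :: "'a::{field, finite} \<Rightarrow> nat \<Rightarrow> ('a^2^2 \<Rightarrow> complex) set" where
  "principal_series \<epsilon> m =
     {f. (\<forall>x. x \<notin> GL2 \<longrightarrow> f x = 0) \<and>
         (\<forall>a b d x. a \<noteq> 0 \<longrightarrow> d \<noteq> 0 \<longrightarrow> x \<in> GL2 \<longrightarrow>
            f (vector [vector [a, b], vector [0, d]] ** x) = mult_char \<epsilon> m a * f x)}"

definition right_translation ::
    "('a::{field, finite})^2^2 \<Rightarrow> ('a^2^2 \<Rightarrow> complex) \<Rightarrow> 'a^2^2 \<Rightarrow> complex" where
  "right_translation g f = (\<lambda>x. f (x ** g))"

lemma subspace_principal_series: "cfun.subspace (principal_series \<epsilon> m)"
  by (auto simp: cfun.subspace_def principal_series_def cfun_scale_def algebra_simps)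

lemma right_translation_in_principal_series:
  fixes g :: "('a::{field, finite})^2^2"
  assumes g: "g \<in> GL2" and f: "f \<in> principal_series \<epsilon> m"
  shows "right_translation g f \<in> principal_series \<epsilon> m"
proof -
  have iff: "x ** g \<in> GL2 \<longleftrightarrow> x \<in> GL2" for x
    using g by (simp add: GL2_def invertible_det_nz det_mul)
  show ?thesis
    using f by (auto simp: principal_series_def right_translation_def iff
        simp flip: matrix_mul_assoc)
qed

lemma right_translation_mult:
  "right_translation (g ** h) f = right_translation g (right_translation h f)"
  by (simp add: right_translation_def matrix_mul_assoc)

definition cross_intersecting ::
    "'a::{field, finite} \<Rightarrow> nat \<Rightarrow> nat \<Rightarrow> ('a^2^2) set \<Rightarrow> ('a^2^2) set \<Rightarrow> bool" where
  "cross_intersecting \<epsilon> m t S1 S2 \<longleftrightarrow>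
     S1 \<subseteq> GL2 \<and> S2 \<subseteq> GL2 \<and>
     (\<forall>g1\<in>S1. \<forall>g2\<in>S2.
        t \<le> cfun.dim {v \<in> principal_series \<epsilon> m. right_translation g1 v = right_translation g2 v})"

end

theory Submission
  imports Defs
begin

text \<open>
  Write \<open>\<kappa> x = x ^ m\<close>, so that \<open>\<mu>\<^sub>m x = 1\<close> iff \<open>\<kappa> x = 1\<close>; the classes \<open>\<kappa> (det x) = n\<close> cut \<open>GL\<^sub>2(q)\<close> into
  \<open>l\<close> pieces of equal size. An element \<open>g\<close> with \<open>\<kappa> (det g) = 1\<close> always fixes a nonzero vector, so each
  piece is cross-intersecting with itself. An element whose eigenvalues both lie in one class
  \<open>z \<noteq> 1\<close> fixes none, since a power of it is the scalar \<open>z\<close>. For the upper bound it suffices that these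
  elements, which are seen by counting the \<open>x\<close> that send the class of \<open>v\<close> to the class of \<open>w\<close>, mix
  different pieces well. The incidence operator between matrices and pairs \<open>(v, w)\<close> has a Gram
  operator of the form \<open>D + R\<close>, where \<open>D\<close> is a scalar and \<open>R\<close> joins pairs in general position; on
  the functions of mean zero the kernel of \<open>R\<^sup>2\<close> reduces to a scalar minus a positive semidefinite
  term. Hence pieces \<open>n \<noteq> n'\<close> with densities \<open>s\<close> and \<open>t\<close> satisfy
  \<open>(q + 1) s t \<le> 2 sqrt (s (1 - s) t (1 - t))\<close>. As \<open>2 (l - 1) \<le> q + 1\<close>, summing over all \<open>n \<noteq> n'\<close>
  gives, by Cauchy-Schwarz, that the total densities have product at most \<open>1\<close>.
\<close>

subsection \<open>Fibres of the \<open>m\<close>-th power map\<close>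

lemma finite_field_power_card:
  fixes x :: "'a::{field, finite}"
  assumes "x \<noteq> 0"
  shows "x ^ (CARD('a) - 1) = 1"
proof -
  have "(\<Prod>y\<in>UNIV - {0}. x * y) = \<Prod>(UNIV - {0})"
    by (rule prod.reindex_bij_witness[of _ "\<lambda>y. y / x" "\<lambda>y. x * y"]) (use assms in auto)
  then have "x ^ card (UNIV - {0 :: 'a}) * \<Prod>(UNIV - {0 :: 'a}) = \<Prod>(UNIV - {0 :: 'a})"
    by (simp add: prod.distrib)
  then show ?thesis by (simp add: card_Diff_singleton)
qed

text \<open>Translation by \<open>1\<close> permutes the field, so the sum of all elements can be
  cancelled. Later this kills the unipotent part of a matrix power.\<close>

lemma finite_field_of_nat_card: "of_nat CARD('a) = (0 :: 'a::{field, finite})"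
proof -
  have "(\<Sum>x\<in>UNIV. x + (1 :: 'a)) = \<Sum>UNIV"
    by (rule sum.reindex_bij_witness[of _ "\<lambda>y. y - 1" "\<lambda>y. y + 1"]) auto
  then show ?thesis by (simp add: sum.distrib)
qed

locale power_classes =
  fixes \<epsilon> :: "'a::{field, finite}" and q l m :: nat
  assumes card_q: "CARD('a) = q"
    and odd_q: "odd q"
    and card_minus_one: "q - 1 = l * m"
    and prime_l: "prime l" and odd_l: "odd l"
    and not_dvd: "\<not> l dvd m"
    and generator: "is_generator \<epsilon>"
begin

lemma m_pos: "0 < m"
  using not_dvd by (cases m) auto

lemma q_eq: "q = l * m + 1"
  using card_minus_one zero_less_card_finite[where 'a = 'a] card_q by linarith

text \<open>\<open>q - 1\<close> is even and \<open>l\<close> is odd, so \<open>m\<close> is even.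
  This gives \<open>2 * l < q\<close>, the room needed in the final estimate.\<close>

lemma m_ge_2: "2 \<le> m"
proof -
  have "even (l * m)" using odd_q q_eq by simp
  then have "even m" using odd_l by simp
  then show ?thesis using m_pos by (cases "m = 1") auto
qed

lemma power_l_m: "x \<noteq> 0 \<Longrightarrow> (x :: 'a) ^ (l * m) = 1"
  using finite_field_power_card[of x] by (simp add: card_q card_minus_one del: One_nat_def)

lemma \<epsilon>_nz: "\<epsilon> \<noteq> 0"
  using generator by (simp add: is_generator_def)

lemma eps_power_eq_one_iff: "\<epsilon> ^ j = 1 \<longleftrightarrow> l * m dvd j"
proof
  assume "\<epsilon> ^ j = 1"
  then show "l * m dvd j"
    using generator_power_eq[OF generator, of 0 j] card_q card_minus_one by simp
next
  assume "l * m dvd j"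
  then obtain t where "j = l * m * t" by auto
  then show "\<epsilon> ^ j = 1"
    using power_l_m[OF \<epsilon>_nz] by (simp only: power_mult[of \<epsilon> "l * m"] power_one)
qed

lemma ex_eps_power: "x \<noteq> 0 \<Longrightarrow> \<exists>j. x = \<epsilon> ^ j"
  using generator by (auto simp: is_generator_def)

lemma eps_power_m_eq_one_iff: "(\<epsilon> ^ j) ^ m = 1 \<longleftrightarrow> l dvd j"
  using m_pos by (simp add: eps_power_eq_one_iff flip: power_mult)

abbreviation \<mu> :: "'a \<Rightarrow> complex" where "\<mu> \<equiv> mult_char \<epsilon> m"

text \<open>The factor \<open>m\<close> cancels against \<open>q - 1 = l * m\<close>, so the values
  of \<open>\<mu>\<close> are \<open>l\<close>-th roots of unity.\<close>

lemma mu_power: "\<mu> (\<epsilon> ^ j) = exp (2 * of_real pi * \<i> * of_nat j / of_nat l)"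
proof -
  have "l > 0" using prime_l prime_gt_0_nat by blast
  then have "2 * of_real pi * \<i> * of_nat m * of_nat j / (of_nat q - 1) =
      2 * of_real pi * \<i> * of_nat j / (of_nat l :: complex)"
    using m_pos by (simp add: q_eq)
  then show ?thesis using mult_char_power[OF generator] card_q by metis
qed

lemma mu_mult:
  assumes "x \<noteq> 0" "y \<noteq> 0"
  shows "\<mu> (x * y) = \<mu> x * \<mu> y"
proof -
  obtain i j where "x = \<epsilon> ^ i" "y = \<epsilon> ^ j" using ex_eps_power assms by meson
  then show ?thesis
    by (simp add: mu_power distrib_left add_divide_distrib exp_add flip: power_add)
qed

lemma mu_nz: "x \<noteq> 0 \<Longrightarrow> \<mu> x \<noteq> 0"
  using ex_eps_power mu_power by fastforce

lemma mu_eq_one_iff: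
  assumes "x \<noteq> 0"
  shows "\<mu> x = 1 \<longleftrightarrow> x ^ m = 1"
proof -
  obtain j where j: "x = \<epsilon> ^ j" using ex_eps_power assms by meson
  have l: "l > 0" using prime_l prime_gt_0_nat by blast
  have "\<mu> x = 1 \<longleftrightarrow> (\<exists>n::int. real j / real l * 2 * pi = 2 * of_int n * pi)"
    unfolding j mu_power exp_eq_1 by (simp add: field_simps)
  also have "\<dots> \<longleftrightarrow> (\<exists>n::int. int j = int l * n)"
  proof (rule ex_cong1)
    fix n :: int
    have "real j / real l * 2 * pi = 2 * of_int n * pi \<longleftrightarrow> real j / real l = of_int n"
      by (metis mult.assoc mult.commute mult_cancel_right pi_neq_zero zero_neq_numeral)
    also have "\<dots> \<longleftrightarrow> real_of_int (int j) = real_of_int (int l * n)"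
      using l by (simp add: field_simps)
    finally show "real j / real l * 2 * pi = 2 * of_int n * pi \<longleftrightarrow> int j = int l * n"
      by (simp only: of_int_eq_iff)
  qed
  also have "\<dots> \<longleftrightarrow> int l dvd int j" by (auto simp: dvd_def)
  finally show ?thesis using eps_power_m_eq_one_iff j by simp
qed

text \<open>The subgroup of order \<open>l\<close> of the multiplicative group; its elements label
  the classes of determinants and of scalars.\<close>

definition N :: "'a set" where "N = (\<lambda>x. x ^ m) ` (UNIV - {0})"

lemma power_m_in_N: "x \<noteq> 0 \<Longrightarrow> x ^ m \<in> N"
  by (auto simp: N_def)

lemma N_nz: "n \<in> N \<Longrightarrow> n \<noteq> 0"
  by (auto simp: N_def)

lemma one_in_N: "1 \<in> N"
  using power_m_in_N[of 1] by simp

lemma N_mult: "a \<in> N \<Longrightarrow> b \<in> N \<Longrightarrow> a * b \<in> N"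
  unfolding N_def by (force simp flip: power_mult_distrib)

lemma N_divide: "a \<in> N \<Longrightarrow> b \<in> N \<Longrightarrow> a / b \<in> N"
  unfolding N_def by (force simp flip: power_divide)

lemma power_in_N_iff: "x ^ m \<in> N \<longleftrightarrow> x \<noteq> 0"
  using N_nz power_m_in_N m_pos by (metis power_eq_0_iff)

lemma N_power_l: "z \<in> N \<Longrightarrow> z ^ l = 1"
proof -
  assume "z \<in> N"
  then obtain x where "x \<noteq> 0" "z = x ^ m" by (auto simp: N_def)
  then show ?thesis using power_l_m[of x] by (simp add: mult.commute flip: power_mult)
qed

text \<open>The order of \<open>z\<close> divides both \<open>l\<close> and \<open>k\<close>. The
  uses are \<open>k = 2\<close>, as \<open>l\<close> is odd, and \<open>k = m\<close>, as
  \<open>l\<close> does not divide \<open>m\<close>.\<close>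

lemma N_power_eq_one:
  assumes "z \<in> N" "z ^ k = 1" "coprime k l"
  shows "z = 1"
proof -
  have "k \<noteq> 0" using assms(3) prime_l by (metis coprime_0_left_iff not_prime_unit)
  then obtain x y where "k * x = l * y + 1"
    using bezout_nat[of k l] assms(3) by (metis coprime_imp_gcd_eq_1)
  then have "z ^ (k * x) = z ^ (l * y + 1)" by simp
  then show ?thesis using N_power_l[OF assms(1)] assms(2) by (simp add: power_mult)
qed

lemma N_square_eq_one: "z \<in> N \<Longrightarrow> z\<^sup>2 = 1 \<Longrightarrow> z = 1"
  using N_power_eq_one[of z 2] odd_l by (simp add: coprime_left_2_iff_odd)

lemma N_power_m_eq_one: "z \<in> N \<Longrightarrow> z ^ m = 1 \<Longrightarrow> z = 1"
  using N_power_eq_one[of z m] prime_l not_dvd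
  by (simp add: coprime_commute prime_imp_coprime)

lemma N_square_root:
  assumes "z \<in> N"
  obtains a where "a \<noteq> 0" "(a ^ m)\<^sup>2 = z"
proof -
  obtain x where x: "x \<noteq> 0" "z = x ^ m" using assms by (auto simp: N_def)
  \<comment> \<open>The exponent \<open>t + 1 = (l + 1) / 2\<close> inverts squaring on a group of
    order \<open>l\<close>.\<close>
  obtain t where t: "l = 2 * t + 1" using odd_l oddE by blast
  have "((x ^ (t + 1)) ^ m)\<^sup>2 = (x ^ m) ^ (l + 1)"
    by (simp add: t algebra_simps flip: power_mult power_add power_Suc)
  also have "\<dots> = z" using N_power_l[OF assms] x by simp
  finally show ?thesis using that[of "x ^ (t + 1)"] x by simp
qed

text \<open>The solutions are the powers of \<open>\<epsilon> ^ l\<close>, which form a cyclic group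
  of order \<open>m\<close>.\<close>

lemma card_power_m_eq_one: "card {x :: 'a. x ^ m = 1} = m"
proof -
  have inj: "inj_on (\<lambda>i. \<epsilon> ^ (l * i)) {..<m}"
  proof (rule linorder_inj_onI')
    fix i j assume ij: "i \<in> {..<m}" "j \<in> {..<m}" "i < j"
    show "\<epsilon> ^ (l * i) \<noteq> \<epsilon> ^ (l * j)"
    proof
      assume "\<epsilon> ^ (l * i) = \<epsilon> ^ (l * j)"
      then have "l * m dvd l * j - l * i"
        using generator_power_eq[OF generator, of "l * i" "l * j"] ij card_q card_minus_one by simp
      then have "l * m dvd l * (j - i)" by (simp add: diff_mult_distrib2)
      then have "m dvd j - i" using prime_l by auto
      then show False using ij by (auto dest: dvd_imp_le)
    qed
  qed
  have "{x :: 'a. x ^ m = 1} = (\<lambda>i. \<epsilon> ^ (l * i)) ` {..<m}"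
  proof (intro equalityI subsetI)
    fix x :: 'a assume x: "x \<in> {x. x ^ m = 1}"
    then have "x \<noteq> 0" using m_pos by (auto simp: power_0_left)
    then obtain j where j: "x = \<epsilon> ^ j" using ex_eps_power by blast
    then obtain t where t: "j = l * t" using x eps_power_m_eq_one_iff by auto
    have "\<epsilon> ^ (l * t) = \<epsilon> ^ (l * (m * (t div m) + t mod m))" by simp
    also have "\<dots> = (\<epsilon> ^ (l * m)) ^ (t div m) * \<epsilon> ^ (l * (t mod m))"
      by (simp only: distrib_left power_add power_mult mult.assoc)
    also have "\<epsilon> ^ (l * m) = 1" by (simp add: eps_power_eq_one_iff)
    finally have "x = \<epsilon> ^ (l * (t mod m))" using j t by simp
    then show "x \<in> (\<lambda>i. \<epsilon> ^ (l * i)) ` {..<m}" using m_pos by auto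
  qed (auto simp: eps_power_m_eq_one_iff)
  then show ?thesis using card_image[OF inj] by simp
qed

lemma card_power_m_eq:
  assumes "n \<in> N"
  shows "card {x :: 'a. x ^ m = n} = m"
proof -
  obtain y where y: "y \<noteq> 0" "n = y ^ m" using assms by (auto simp: N_def)
  have "bij_betw (\<lambda>x. y * x) {x :: 'a. x ^ m = 1} {x. x ^ m = n}"
    by (rule bij_betw_byWitness[where f' = "\<lambda>x. x / y"])
      (use y in \<open>auto simp: power_mult_distrib power_divide\<close>)
  then show ?thesis using card_power_m_eq_one bij_betw_same_card by fastforce
qed

lemma card_N: "card N = l"
proof -
  have "UNIV - {0 :: 'a} = (\<Union>n\<in>N. {x. x ^ m = n})"
    using N_nz power_in_N_iff by auto
  then have "card (UNIV - {0 :: 'a}) = (\<Sum>n\<in>N. card {x :: 'a. x ^ m = n})"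
    by (simp only:) (rule card_UN_disjoint, auto)
  then have "l * m = card N * m"
    using card_power_m_eq by (simp add: card_Diff_singleton card_q q_eq)
  then show ?thesis using m_pos by simp
qed

end

subsection \<open>Vectors and matrices of size two\<close>

text \<open>The determinant of the matrix with columns \<open>v\<close> and \<open>w\<close>; for
  nonzero vectors it vanishes exactly when they are parallel.\<close>

definition bracket :: "'a::field^2 \<Rightarrow> 'a^2 \<Rightarrow> 'a" where
  "bracket v w = v$1 * w$2 - v$2 * w$1"

lemma bracket_mult: "bracket (A *v u) (A *v v) = det A * bracket u v"
  by (simp add: bracket_def det_2 matrix_vector_mult_def sum_2 algebra_simps)

lemma bracket_scale_left [simp]: "bracket (c *s u) v = c * bracket u v"
  by (simp add: bracket_def algebra_simps)

lemma bracket_scale_right [simp]: "bracket u (c *s v) = c * bracket u v"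
  by (simp add: bracket_def algebra_simps)

lemma bracket_add_right: "bracket u (v + w) = bracket u v + bracket u w"
  by (simp add: bracket_def algebra_simps)

lemma bracket_same [simp]: "bracket u u = 0"
  by (simp add: bracket_def)

lemma bracket_zero [simp]: "bracket 0 v = 0" "bracket v 0 = 0"
  by (simp_all add: bracket_def)

lemma bracket_swap: "bracket v u = - bracket u v"
  by (simp add: bracket_def algebra_simps)

lemma vec2_zero_iff: "(v :: 'a::zero^2) = 0 \<longleftrightarrow> v$1 = 0 \<and> v$2 = 0"
  by (simp add: vec_eq_iff forall_2)

lemma bracket_eq_zeroE:
  assumes "bracket v w = 0" "v \<noteq> 0"
  obtains c where "w = c *s v"
proof (cases "v$1 = 0")
  case True
  then have "w = (w$2 / v$2) *s v" using assms
    by (auto simp: vec2_zero_iff vec_eq_iff forall_2 bracket_def)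
  then show ?thesis using that by blast
next
  case False
  then have "w = (w$1 / v$1) *s v" using assms
    by (auto simp: vec_eq_iff forall_2 bracket_def field_simps)
  then show ?thesis using that by blast
qed

lemma ex_bracket_nz:
  assumes "v \<noteq> 0"
  obtains u where "bracket v u \<noteq> 0"
proof (cases "v$1 = 0")
  case True
  then show ?thesis using assms that[of "axis 1 1"]
    by (auto simp: vec2_zero_iff bracket_def axis_def)
next
  case False
  then show ?thesis using that[of "axis 2 1"] by (auto simp: bracket_def axis_def)
qed

text \<open>Cramer's rule.\<close>

lemma bracket_expand:
  assumes "bracket v v' \<noteq> 0"
  shows "u = (bracket u v' / bracket v v') *s v + (bracket v u / bracket v v') *s v'"
proof -
  have "bracket u v' * v$1 + bracket v u * v'$1 = u$1 * bracket v v'"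
    "bracket u v' * v$2 + bracket v u * v'$2 = u$2 * bracket v v'"
    by (simp_all add: bracket_def algebra_simps)
  then have "(bracket u v' * v$1 + bracket v u * v'$1) / bracket v v' = u$1"
    "(bracket u v' * v$2 + bracket v u * v'$2) / bracket v v' = u$2"
    using assms by simp_all
  then show ?thesis
    by (simp add: vec_eq_iff forall_2 add_divide_distrib)
qed

lemma matrix_eq_on_basis:
  assumes "bracket v v' \<noteq> 0" "A *v v = B *v v" "A *v v' = B *v v'"
  shows "A = B"
proof -
  have "A *v u = B *v u" for u
    using bracket_expand[OF assms(1), of u] assms(2,3)
    by (metis matrix_vector_right_distrib vector_scalar_commute)
  then show ?thesis by (simp add: matrix_eq)
qed

lemma inj_imp_bij_card:
  fixes f :: "'a::finite \<Rightarrow> 'b::finite"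
  assumes "inj f" "CARD('a) = CARD('b)"
  shows "bij f"
proof -
  have "card (range f) = CARD('b)" using assms by (simp add: card_image)
  then have "range f = UNIV" by (simp add: card_eq_UNIV_imp_eq_UNIV)
  then show ?thesis using assms(1) by (simp add: bij_def)
qed

lemma card_Collect_bij:
  assumes "bij f"
  shows "card {x. P (f x)} = card {y. P y}"
proof -
  have "{y. P y} = f ` {x. P (f x)}"
    using assms by (auto simp: bij_def dest: surjD)
  moreover have "inj_on f {x. P (f x)}"
    using assms by (meson bij_def inj_on_subset subset_UNIV)
  ultimately show ?thesis by (simp add: card_image)
qed

lemma card_Collect_pair:
  "card {(x :: 'a::finite, y :: 'b::finite). P x y} = (\<Sum>x\<in>UNIV. card {y. P x y})"
proof -
  have "{(x, y). P x y} = (SIGMA x:UNIV. {y. P x y})" by auto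
  then show ?thesis by simp
qed

lemma card_Collect_pair':
  fixes P :: "'a::finite \<Rightarrow> 'b::finite \<Rightarrow> bool"
  assumes "\<And>x. Q x \<Longrightarrow> card {y. P x y} = k" "\<And>x y. P x y \<Longrightarrow> Q x"
  shows "card {(x, y). P x y} = card {x. Q x} * k"
proof -
  have "{y. P x y} = {}" if "\<not> Q x" for x using assms(2) that by auto
  then have "card {(x, y). P x y} = (\<Sum>x\<in>UNIV. if Q x then k else 0)"
    unfolding card_Collect_pair using assms(1) by (intro sum.cong) auto
  then show ?thesis by (simp flip: sum.inter_filter)
qed

text \<open>The brackets with a basis serve as coordinates, so counts of vectors become counts of
  pairs of field elements.\<close>

lemma bij_bracket_pair:
  fixes v v' :: "'a::{field, finite}^2"
  assumes "bracket v v' \<noteq> 0"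
  shows "bij (\<lambda>u. (bracket u v, bracket u v'))"
proof (rule inj_imp_bij_card)
  show "inj (\<lambda>u. (bracket u v, bracket u v'))"
  proof (rule injI)
    fix x y assume "(bracket x v, bracket x v') = (bracket y v, bracket y v')"
    then have "bracket x v' = bracket y v'" "bracket v x = bracket v y"
      using bracket_swap[of v] by auto
    then show "x = y" using bracket_expand[OF assms] by metis
  qed
qed (simp add: power2_eq_square)

text \<open>A matrix amounts to a free choice of the images of a basis.\<close>

lemma bij_matrix_vector_pair:
  fixes v v' :: "'a::{field, finite}^2"
  assumes "bracket v v' \<noteq> 0"
  shows "bij (\<lambda>A :: 'a^2^2. (A *v v, A *v v'))"
  by (rule inj_imp_bij_card)
    (use matrix_eq_on_basis[OF assms] in \<open>auto intro: injI simp: power2_eq_square\<close>)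

lemma card_bracket_pair:
  fixes v v' :: "'a::{field, finite}^2"
  assumes "bracket v v' \<noteq> 0"
  shows "card {u. P (bracket u v) (bracket u v')} = card {(\<alpha>, \<beta>). P \<alpha> \<beta>}"
  using card_Collect_bij[OF bij_bracket_pair[OF assms], of "\<lambda>(\<alpha>, \<beta>). P \<alpha> \<beta>"] by simp

lemma card_bracket:
  fixes v :: "'a::{field, finite}^2"
  assumes "v \<noteq> 0"
  shows "card {u. P (bracket u v)} = card {\<alpha>. P \<alpha>} * CARD('a)"
proof -
  obtain v' where "bracket v v' \<noteq> 0" using ex_bracket_nz[OF assms] .
  then have "card {u. P (bracket u v)} = card {(\<alpha>, \<beta> :: 'a). P \<alpha>}"
    using card_bracket_pair[of v v' "\<lambda>\<alpha> \<beta>. P \<alpha>"] by simp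
  also have "\<dots> = card {\<alpha>. P \<alpha>} * CARD('a)"
    by (rule card_Collect_pair') auto
  finally show ?thesis .
qed

lemma card_matrix_vector_pair:
  fixes v v' :: "'a::{field, finite}^2"
  assumes "bracket v v' \<noteq> 0"
  shows "card {A :: 'a^2^2. P (A *v v) (A *v v')} = card {(u, u'). P u u'}"
  using card_Collect_bij[OF bij_matrix_vector_pair[OF assms], of "\<lambda>(u, u'). P u u'"] by simp

section \<open>Counting matrices and cells by class\<close>

context power_classes
begin

text \<open>The classes are the orbits of nonzero vectors under the \<open>m\<close> scalars in the
  kernel of \<open>\<mu>\<close>.\<close>

definition sim :: "'a^2 \<Rightarrow> 'a^2 \<Rightarrow> bool" where
  "sim u w \<longleftrightarrow> u \<noteq> 0 \<and> (\<exists>k. k ^ m = 1 \<and> u = k *s w)"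

lemma power_m_zero [simp]: "(0 :: 'a) ^ m = 0"
  using m_pos by (simp add: power_0_left)

lemma power_m_one_nz: "k ^ m = 1 \<Longrightarrow> (k :: 'a) \<noteq> 0"
  by auto

lemma sim_nz: "sim u w \<Longrightarrow> u \<noteq> 0" "sim u w \<Longrightarrow> w \<noteq> 0"
  by (auto simp: sim_def)

lemma sim_refl: "u \<noteq> 0 \<Longrightarrow> sim u u"
  unfolding sim_def by (metis power_one scalar_mult_eq_scaleR vector_smult_lid)

lemma sim_sym: "sim u w \<Longrightarrow> sim w u"
proof -
  assume "sim u w"
  then obtain k where k: "u \<noteq> 0" "k ^ m = 1" "u = k *s w" by (auto simp: sim_def)
  then have "w = (1 / k) *s u" "(1 / k) ^ m = 1"
    using power_m_one_nz[OF k(2)] by (auto simp: vector_smult_assoc power_divide)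
  then show ?thesis using k by (auto simp: sim_def)
qed

lemma sim_trans: "sim u v \<Longrightarrow> sim v w \<Longrightarrow> sim u w"
  unfolding sim_def by (metis power_mult_distrib mult_1 vector_smult_assoc)

lemma sim_scale:
  assumes "sim u w" "c \<noteq> 0" "c ^ m = c' ^ m"
  shows "sim (c *s u) (c' *s w)"
proof -
  obtain k where k: "u \<noteq> 0" "k ^ m = 1" "u = k *s w" using assms by (auto simp: sim_def)
  have c': "c' \<noteq> 0" using assms m_pos by auto
  have "(c * k / c') ^ m = 1" using assms k c' by (simp add: power_mult_distrib power_divide)
  moreover have "c *s u = (c * k / c') *s (c' *s w)" using k c' by (simp add: vector_smult_assoc)
  moreover have "c *s u \<noteq> 0" using k assms by (simp add: vector_mul_eq_0)
  ultimately show ?thesis unfolding sim_def by blast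
qed

lemma sim_scale_iff:
  assumes "c \<noteq> 0" "c ^ m = c' ^ m"
  shows "sim (c *s u) (c' *s w) \<longleftrightarrow> sim u w"
proof
  have c': "c' \<noteq> 0" using assms m_pos by auto
  assume "sim (c *s u) (c' *s w)"
  from sim_scale[OF this, of "1 / c" "1 / c'"] show "sim u w"
    using assms c' by (simp add: vector_smult_assoc power_divide)
qed (use sim_scale assms in blast)

lemma card_sim:
  assumes "w \<noteq> 0"
  shows "card {u. sim u w} = m"
proof -
  have "{u. sim u w} = (\<lambda>k. k *s w) ` {k. k ^ m = 1}"
    using assms by (auto simp: sim_def vector_mul_eq_0)
  moreover have "inj_on (\<lambda>k. k *s w) {k. k ^ m = 1}"
    using assms by (auto intro: inj_onI simp: vector_mul_rcancel)
  ultimately show ?thesis by (simp add: card_image card_power_m_eq_one)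
qed

lemma card_sim': "w \<noteq> 0 \<Longrightarrow> card {u. sim w u} = m"
  using card_sim sim_sym by (metis (no_types, lifting) Collect_cong)

lemma bracket_sim: "sim u w \<Longrightarrow> sim u' w' \<Longrightarrow> bracket u u' ^ m = bracket w w' ^ m"
  by (auto simp: sim_def power_mult_distrib)

definition det_class :: "'a \<Rightarrow> ('a^2^2) set" where
  "det_class n = {x. det x ^ m = n}"

text \<open>The determinant class is read off from the images of a basis alone, in the form that
  \<open>card_matrix_vector_pair\<close> counts.\<close>

lemma det_class_iff_bracket:
  assumes "bracket v v' \<noteq> 0"
  shows "x \<in> det_class n \<longleftrightarrow> bracket (x *v v) (x *v v') ^ m = n * bracket v v' ^ m"
  using assms by (simp add: det_class_def bracket_mult power_mult_distrib)

lemma card_bracket_class: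
  assumes "u \<noteq> 0" "n \<in> N"
  shows "card {u'. bracket u u' ^ m = n} = m * q"
proof -
  have "card {u'. bracket u u' ^ m = n} = card {u'. (- bracket u' u) ^ m = n}"
    by (metis bracket_swap)
  also have "\<dots> = card {\<alpha> :: 'a. (- \<alpha>) ^ m = n} * q"
    using card_bracket[OF assms(1), of "\<lambda>\<alpha>. (- \<alpha>) ^ m = n"] card_q by simp
  also have "card {\<alpha> :: 'a. (- \<alpha>) ^ m = n} = card {\<alpha> :: 'a. \<alpha> ^ m = n}"
    by (rule card_Collect_bij) (simp add: bij_uminus)
  finally show ?thesis using card_power_m_eq[OF assms(2)] by simp
qed

lemma card_nonzero_vec: "card {u :: 'a^2. u \<noteq> 0} = q\<^sup>2 - 1"
proof -
  have "{u :: 'a^2. u \<noteq> 0} = UNIV - {0}" by auto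
  then show ?thesis by (simp add: card_Diff_singleton card_q)
qed

lemma bracket_class_in_N:
  "n \<in> N \<Longrightarrow> c \<noteq> 0 \<Longrightarrow> n * c ^ m \<in> N"
  using N_mult power_m_in_N by blast

lemma bracket_class_nz:
  assumes "n \<in> N" "bracket u u' ^ m = n"
  shows "u \<noteq> 0" "u' \<noteq> 0"
  using assms N_nz[of n] by auto

definition class_size :: nat where "class_size = (q\<^sup>2 - 1) * (m * q)"

lemma card_det_class:
  assumes "n \<in> N"
  shows "card (det_class n) = class_size"
proof -
  obtain v v' :: "'a^2" where v: "bracket v v' \<noteq> 0"
    by (rule ex_bracket_nz[of "axis 1 1"]) (auto simp: axis_eq_0_iff)
  have n': "n * bracket v v' ^ m \<in> N" using bracket_class_in_N assms v by blast
  have "card (det_class n) = card {(u, u'). bracket u u' ^ m = n * bracket v v' ^ m}"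
    using card_matrix_vector_pair[OF v, of "\<lambda>u u'. bracket u u' ^ m = n * bracket v v' ^ m"]
    by (simp flip: det_class_iff_bracket[OF v])
  also have "\<dots> = card {u :: 'a^2. u \<noteq> 0} * (m * q)"
    by (rule card_Collect_pair') (use card_bracket_class n' bracket_class_nz in blast)+
  finally show ?thesis using card_nonzero_vec by (simp add: class_size_def)
qed

text \<open>The image of \<open>v\<close> ranges over a class of \<open>m\<close> vectors; the image
  of a second basis vector then has \<open>m * q\<close> choices in the prescribed determinant
  class.\<close>

lemma card_block:
  assumes "n \<in> N" "v \<noteq> 0" "w \<noteq> 0"
  shows "card {x \<in> det_class n. sim (x *v v) w} = q * m\<^sup>2"
proof -
  obtain v' :: "'a^2" where v: "bracket v v' \<noteq> 0" using ex_bracket_nz assms by blast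
  have n': "n * bracket v v' ^ m \<in> N" using bracket_class_in_N assms v by blast
  have "card {x \<in> det_class n. sim (x *v v) w} =
      card {(u, u'). bracket u u' ^ m = n * bracket v v' ^ m \<and> sim u w}"
    using card_matrix_vector_pair[OF v, of "\<lambda>u u'. bracket u u' ^ m = n * bracket v v' ^ m \<and> sim u w"]
    by (simp flip: det_class_iff_bracket[OF v])
  also have "\<dots> = card {u. sim u w} * (m * q)"
    by (rule card_Collect_pair') (use card_bracket_class[OF _ n'] sim_nz in auto)
  finally show ?thesis using card_sim[OF assms(3)] by (simp add: power2_eq_square)
qed

text \<open>Pairs of vectors are the cells: \<open>(v, w)\<close> stands for the matrices \<open>x\<close> with
  \<open>x *v v\<close> in the class of \<open>w\<close>.\<close>

definition transversal :: "'a \<Rightarrow> ('a^2) \<times> ('a^2) \<Rightarrow> ('a^2) \<times> ('a^2) \<Rightarrow> bool" where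
  "transversal n i j \<longleftrightarrow> bracket (fst i) (fst j) \<noteq> 0 \<and>
     bracket (snd i) (snd j) ^ m = n * bracket (fst i) (fst j) ^ m"

text \<open>The two pairs describe the same cell: both vectors are rescaled, by scalars of one
  class.\<close>

definition cell_eq :: "('a^2) \<times> ('a^2) \<Rightarrow> ('a^2) \<times> ('a^2) \<Rightarrow> bool" where
  "cell_eq i j \<longleftrightarrow> (\<exists>c c'. c \<noteq> 0 \<and> c ^ m = c' ^ m \<and> fst j = c *s fst i \<and> snd j = c' *s snd i)"

lemma cell_eq_iff_sim:
  assumes "v' = c *s v" "c \<noteq> 0" "v \<noteq> 0" "w \<noteq> 0"
  shows "cell_eq (v, w) (v', w') \<longleftrightarrow> sim (c *s w) w'"
proof
  assume "cell_eq (v, w) (v', w')"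
  then obtain b b' where b: "b \<noteq> 0" "b ^ m = b' ^ m" "v' = b *s v" "w' = b' *s w"
    by (auto simp: cell_eq_def)
  then have "b = c" using assms by (simp add: vector_mul_rcancel)
  then show "sim (c *s w) w'" using b sim_scale[OF sim_refl[OF assms(4)], of b b'] by simp
next
  assume "sim (c *s w) w'"
  then obtain k where "k ^ m = 1" "w' = k *s (c *s w)"
    by (meson sim_sym sim_def)
  then show "cell_eq (v, w) (v', w')" unfolding cell_eq_def fst_conv snd_conv
    by (intro exI[of _ c] exI[of _ "k * c"])
      (use assms in \<open>simp add: power_mult_distrib vector_smult_assoc\<close>)
qed

text \<open>An entry of the Gram matrix of the incidence operator. If \<open>v\<close> and
  \<open>v'\<close> are independent, the determinant class depends only on the classes of the two
  images, so all \<open>m * m\<close> choices count or none does. If they are parallel, the two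
  cells coincide or are disjoint.\<close>

lemma card_two_cells:
  assumes n: "n \<in> N" and nz: "v \<noteq> 0" "w \<noteq> 0" "v' \<noteq> 0" "w' \<noteq> 0"
  shows "card {x \<in> det_class n. sim (x *v v) w \<and> sim (x *v v') w'} =
    m\<^sup>2 * of_bool (transversal n (v, w) (v', w')) + q * m\<^sup>2 * of_bool (cell_eq (v, w) (v', w'))"
proof (cases "bracket v v' = 0")
  case False
  note v = this
  have not_eq: "\<not> cell_eq (v, w) (v', w')" using v by (auto simp: cell_eq_def)
  have "card {x \<in> det_class n. sim (x *v v) w \<and> sim (x *v v') w'} =
      card {(u, u'). bracket u u' ^ m = n * bracket v v' ^ m \<and> sim u w \<and> sim u' w'}"
    using card_matrix_vector_pair[OF v,
        of "\<lambda>u u'. bracket u u' ^ m = n * bracket v v' ^ m \<and> sim u w \<and> sim u' w'"]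
    by (simp flip: det_class_iff_bracket[OF v])
  also have "{(u, u'). bracket u u' ^ m = n * bracket v v' ^ m \<and> sim u w \<and> sim u' w'} =
      (if transversal n (v, w) (v', w') then {u. sim u w} \<times> {u'. sim u' w'} else {})"
    using bracket_sim v by (auto simp: transversal_def)
  finally show ?thesis using not_eq card_sim nz by (simp add: power2_eq_square)
next
  case True
  then obtain c where c: "v' = c *s v" using bracket_eq_zeroE nz by metis
  then have c0: "c \<noteq> 0" using nz by auto
  have "sim (x *v v') w' \<longleftrightarrow> sim (c *s w) w'" if "sim (x *v v) w" for x
  proof -
    have "sim (c *s (x *v v)) (c *s w)" using sim_scale that c0 by blast
    then show ?thesis unfolding c vector_scalar_commute using sim_sym sim_trans by blast
  qed
  then have "{x \<in> det_class n. sim (x *v v) w \<and> sim (x *v v') w'} =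
      (if cell_eq (v, w) (v', w') then {x \<in> det_class n. sim (x *v v) w} else {})"
    unfolding cell_eq_iff_sim[OF c c0 nz(1,2)] by auto
  then show ?thesis using card_block[OF n nz(1,2)] True by (simp add: transversal_def)
qed

lemma card_cell_eq:
  assumes "v \<noteq> 0" "w \<noteq> 0"
  shows "card {j. cell_eq (v, w) j} = (q - 1) * m"
proof -
  have "{j. cell_eq (v, w) j} =
      (\<lambda>(c, c'). (c *s v, c' *s w)) ` (SIGMA c:{c. c \<noteq> 0}. {c'. c' ^ m = c ^ m})"
    unfolding cell_eq_def image_iff set_eq_iff mem_Collect_eq split_paired_all by auto metis+
  moreover have "inj_on (\<lambda>(c, c'). (c *s v, c' *s w)) (SIGMA c:{c. c \<noteq> 0}. {c'. c' ^ m = c ^ m})"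
    using assms by (auto intro!: inj_onI simp: vector_mul_rcancel)
  ultimately have "card {j. cell_eq (v, w) j} =
      card (SIGMA c:{c :: 'a. c \<noteq> 0}. {c' :: 'a. c' ^ m = c ^ m})"
    by (simp add: card_image)
  also have "\<dots> = card {c :: 'a. c \<noteq> 0} * m"
    using card_power_m_eq power_m_in_N by simp
  also have "{c :: 'a. c \<noteq> 0} = UNIV - {0}" by auto
  finally show ?thesis by (simp add: card_Diff_singleton card_q)
qed

lemma card_pair_class:
  assumes "b \<in> N"
  shows "card {(\<alpha> :: 'a, \<beta> :: 'a). \<alpha> \<noteq> 0 \<and> \<beta> ^ m = b * \<alpha> ^ m} = (q - 1) * m"
proof -
  have "card {(\<alpha> :: 'a, \<beta> :: 'a). \<alpha> \<noteq> 0 \<and> \<beta> ^ m = b * \<alpha> ^ m} = card {\<alpha> :: 'a. \<alpha> \<noteq> 0} * m"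
    by (rule card_Collect_pair') (use card_power_m_eq bracket_class_in_N assms in auto)
  also have "{c :: 'a. c \<noteq> 0} = UNIV - {0}" by auto
  finally show ?thesis by (simp add: card_Diff_singleton card_q)
qed

text \<open>An entry of the square of the transversal kernel, with cases according to whether
  \<open>v'\<close>, \<open>v''\<close> and \<open>w'\<close>, \<open>w''\<close> are parallel. The
  formula isolates the terms that see only one side, since these vanish on functions of mean zero;
  the last coefficient makes the total zero when both sides are parallel without
  \<open>cell_eq\<close>.\<close>

lemma card_two_transversals:
  assumes n: "n \<in> N" and nz: "v' \<noteq> 0" "w' \<noteq> 0" "v'' \<noteq> 0" "w'' \<noteq> 0"
  shows "real (card {(v, w). transversal n (v, w) (v', w') \<and> transversal n (v, w) (v'', w'')}) =
    (real q - 1)\<^sup>2 * m\<^sup>2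
    + (real q - 1) * m\<^sup>2 * of_bool (bracket v' v'' = 0)
    + (real q - 1) * m\<^sup>2 * of_bool (bracket w' w'' = 0)
    + q\<^sup>2 * m * (real q - 1) * of_bool (cell_eq (v', w') (v'', w''))
    - ((real q)\<^sup>2 - 1) * m\<^sup>2 * of_bool (bracket v' v'' = 0 \<and> bracket w' w'' = 0)"
proof -
  let ?T = "card {(v, w). transversal n (v, w) (v', w') \<and> transversal n (v, w) (v'', w'')}"
  have q1: "q \<ge> 1" using q_eq by simp
  have nz_set: "{c :: 'a. c \<noteq> 0} = UNIV - {0}" by auto
  have card_nz: "card {c :: 'a. c \<noteq> 0} = q - 1"
    unfolding nz_set by (simp add: card_Diff_singleton card_q)
  have card_indep: "card {v. bracket v v' \<noteq> 0 \<and> bracket v v'' \<noteq> 0} = (q - 1) * (q - 1)"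
    if "bracket v' v'' \<noteq> 0"
  proof -
    have "card {v. bracket v v' \<noteq> 0 \<and> bracket v v'' \<noteq> 0} =
        card {(\<alpha> :: 'a, \<beta> :: 'a). \<alpha> \<noteq> 0 \<and> \<beta> \<noteq> 0}"
      by (rule card_bracket_pair[OF that])
    also have "\<dots> = card {\<alpha> :: 'a. \<alpha> \<noteq> 0} * (q - 1)"
      by (rule card_Collect_pair') (use card_nz in auto)
    finally show ?thesis using card_nz by simp
  qed
  have card_dep: "card {v. bracket v v' \<noteq> 0} = (q - 1) * q"
    using card_bracket[OF nz(1), of "\<lambda>\<alpha>. \<alpha> \<noteq> 0"] card_nz card_q by simp
  show ?thesis
  proof (cases "bracket w' w'' = 0")
    case False
    then have w: "\<not> cell_eq (v', w') (v'', w'')" by (auto simp: cell_eq_def)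
    \<comment> \<open>The brackets of \<open>w\<close> with \<open>w'\<close> and \<open>w''\<close>
      are independent coordinates, each with \<open>m\<close> admissible values.\<close>
    have inner: "card {w. bracket w w' ^ m = a \<and> bracket w w'' ^ m = b} = m\<^sup>2"
      if "a \<in> N" "b \<in> N" for a b
    proof -
      have "card {w. bracket w w' ^ m = a \<and> bracket w w'' ^ m = b} =
          card {(\<alpha> :: 'a, \<beta> :: 'a). \<alpha> ^ m = a \<and> \<beta> ^ m = b}"
        by (rule card_bracket_pair[OF False])
      also have "\<dots> = card {\<alpha> :: 'a. \<alpha> ^ m = a} * m"
        by (rule card_Collect_pair') (use card_power_m_eq that in auto)
      finally show ?thesis using card_power_m_eq that by (simp add: power2_eq_square)
    qed
    have T: "?T = card {v. bracket v v' \<noteq> 0 \<and> bracket v v'' \<noteq> 0} * m\<^sup>2"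
      unfolding transversal_def fst_conv snd_conv
    proof (rule card_Collect_pair')
      fix v assume "bracket v v' \<noteq> 0 \<and> bracket v v'' \<noteq> 0"
      then show "card {w. (bracket v v' \<noteq> 0 \<and> bracket w w' ^ m = n * bracket v v' ^ m) \<and>
          bracket v v'' \<noteq> 0 \<and> bracket w w'' ^ m = n * bracket v v'' ^ m} = m\<^sup>2"
        using inner bracket_class_in_N n by simp
    qed auto
    show ?thesis
    proof (cases "bracket v' v'' = 0")
      case True
      then obtain c where "v'' = c *s v'" using bracket_eq_zeroE nz by metis
      then have "{v. bracket v v' \<noteq> 0 \<and> bracket v v'' \<noteq> 0} = {v. bracket v v' \<noteq> 0}"
        using nz by auto
      then show ?thesis using T card_dep w False True q1
        by (simp add: of_nat_diff power2_eq_square algebra_simps)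
    next
      case v: False
      have "real ?T = (real q - 1)\<^sup>2 * m\<^sup>2"
        unfolding T card_indep[OF v] using q1 by (simp add: of_nat_diff power2_eq_square)
      then show ?thesis using w False v by simp
    qed
  next
    case True
    then obtain c where c: "w'' = c *s w'" using bracket_eq_zeroE nz by metis
    then have c0: "c \<noteq> 0" using nz by auto
    \<comment> \<open>As \<open>w'' = c *s w'\<close>, the two conditions on \<open>w\<close> agree
      or contradict each other according to a condition on \<open>v\<close> alone; when they agree,
      \<open>w\<close> has \<open>m * q\<close> choices.\<close>
    have T: "?T = card {v. bracket v v' \<noteq> 0 \<and> bracket v v'' ^ m = c ^ m * bracket v v' ^ m} * (m * q)"
      unfolding transversal_def fst_conv snd_conv
    proof (rule card_Collect_pair')
      fix v assume v: "bracket v v' \<noteq> 0 \<and> bracket v v'' ^ m = c ^ m * bracket v v' ^ m"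
      then have "bracket v v'' \<noteq> 0" using c0 by auto
      then have "{w. (bracket v v' \<noteq> 0 \<and> bracket w w' ^ m = n * bracket v v' ^ m) \<and>
          bracket v v'' \<noteq> 0 \<and> bracket w w'' ^ m = n * bracket v v'' ^ m} =
          {w. bracket w w' ^ m = n * bracket v v' ^ m}"
        using v c by (auto simp: power_mult_distrib)
      then show "card {w. (bracket v v' \<noteq> 0 \<and> bracket w w' ^ m = n * bracket v v' ^ m) \<and>
          bracket v v'' \<noteq> 0 \<and> bracket w w'' ^ m = n * bracket v v'' ^ m} = m * q"
        using card_bracket[OF nz(2), of "\<lambda>\<alpha>. \<alpha> ^ m = n * bracket v v' ^ m"] v n
          card_power_m_eq bracket_class_in_N card_q by simp
    next
      fix v w
      assume "(bracket v v' \<noteq> 0 \<and> bracket w w' ^ m = n * bracket v v' ^ m) \<and>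
          bracket v v'' \<noteq> 0 \<and> bracket w w'' ^ m = n * bracket v v'' ^ m"
      then show "bracket v v' \<noteq> 0 \<and> bracket v v'' ^ m = c ^ m * bracket v v' ^ m"
        using N_nz[OF n] c by (auto simp: power_mult_distrib)
    qed
    show ?thesis
    proof (cases "bracket v' v'' = 0")
      case v: True
      then obtain b where b: "v'' = b *s v'" using bracket_eq_zeroE nz by metis
      then have b0: "b \<noteq> 0" using nz by auto
      have eq: "cell_eq (v', w') (v'', w'') \<longleftrightarrow> b ^ m = c ^ m"
        using b c b0 nz by (auto simp: cell_eq_def vector_mul_rcancel)
      have "{v. bracket v v' \<noteq> 0 \<and> bracket v v'' ^ m = c ^ m * bracket v v' ^ m} =
          (if b ^ m = c ^ m then {v. bracket v v' \<noteq> 0} else {})"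
        by (auto simp: b power_mult_distrib)
      then show ?thesis using T card_dep eq v True q1
        by (simp add: of_nat_diff power2_eq_square algebra_simps)
    next
      case v: False
      then have "\<not> cell_eq (v', w') (v'', w'')" by (auto simp: cell_eq_def)
      moreover have "card {v. bracket v v' \<noteq> 0 \<and> bracket v v'' ^ m = c ^ m * bracket v v' ^ m} =
          (q - 1) * m"
        using card_bracket_pair[OF v, of "\<lambda>\<alpha> \<beta>. \<alpha> \<noteq> 0 \<and> \<beta> ^ m = c ^ m * \<alpha> ^ m"]
          card_pair_class[OF power_m_in_N[OF c0]] by simp
      ultimately show ?thesis using T v True q1
        by (simp add: of_nat_diff power2_eq_square algebra_simps)
    qed
  qed
qed

end

subsection \<open>The spectral bound\<close>

lemma sum_UNIV_pair:
  "(\<Sum>i\<in>UNIV. f i) = (\<Sum>v\<in>UNIV. \<Sum>w\<in>UNIV. f (v :: 'a::finite, w :: 'b::finite))"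
  by (simp add: sum.cartesian_product)

lemma sum_of_bool: "finite A \<Longrightarrow> (\<Sum>x\<in>A. of_bool (P x) :: real) = card {x \<in> A. P x}"
  by (simp add: of_bool_def flip: sum.inter_filter)

lemma sum_square_gram:
  fixes k :: "'x \<Rightarrow> 'i \<Rightarrow> real"
  shows "(\<Sum>x\<in>X. (\<Sum>i\<in>I. k x i * F i)\<^sup>2) = (\<Sum>i\<in>I. \<Sum>j\<in>I. F i * F j * (\<Sum>x\<in>X. k x i * k x j))"
proof -
  have "(\<Sum>x\<in>X. (\<Sum>i\<in>I. k x i * F i)\<^sup>2) = (\<Sum>x\<in>X. \<Sum>i\<in>I. \<Sum>j\<in>I. F i * F j * (k x i * k x j))"
    by (simp add: power2_eq_square sum_product mult_ac)
  also have "\<dots> = (\<Sum>i\<in>I. \<Sum>x\<in>X. \<Sum>j\<in>I. F i * F j * (k x i * k x j))"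
    by (rule sum.swap)
  also have "\<dots> = (\<Sum>i\<in>I. \<Sum>j\<in>I. \<Sum>x\<in>X. F i * F j * (k x i * k x j))"
    by (intro sum.cong refl sum.swap)
  finally show ?thesis by (simp add: sum_distrib_left)
qed

text \<open>\<open>F\<close> is the transpose of \<open>k\<close> applied to \<open>\<phi>\<close>,
  so its squared norm is the inner product of \<open>\<phi>\<close> with \<open>k\<close> applied to
  \<open>F\<close>, and Cauchy-Schwarz with \<open>adj\<close> gives the bound. \<open>adj\<close>
  concerns this \<open>F\<close> only, since it will be proved just for lifts of functions of mean
  zero.\<close>

lemma sum_square_le_of_adjoint:
  fixes k :: "'x \<Rightarrow> 'i \<Rightarrow> real"
  assumes F: "\<And>i. i \<in> I \<Longrightarrow> F i = (\<Sum>x\<in>X. \<phi> x * k x i)"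
    and adj: "(\<Sum>x\<in>X. (\<Sum>i\<in>I. k x i * F i)\<^sup>2) \<le> L * (\<Sum>i\<in>I. (F i)\<^sup>2)"
    and "0 \<le> L"
  shows "(\<Sum>i\<in>I. (F i)\<^sup>2) \<le> L * (\<Sum>x\<in>X. (\<phi> x)\<^sup>2)"
proof (cases "(\<Sum>i\<in>I. (F i)\<^sup>2) = 0")
  case True
  then show ?thesis using \<open>0 \<le> L\<close> by (simp add: sum_nonneg)
next
  case False
  then have pos: "(\<Sum>i\<in>I. (F i)\<^sup>2) > 0" by (simp add: order_less_le sum_nonneg)
  have "(\<Sum>i\<in>I. (F i)\<^sup>2) = (\<Sum>i\<in>I. \<Sum>x\<in>X. \<phi> x * k x i * F i)"
    by (simp add: power2_eq_square F flip: sum_distrib_right)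
  also have "\<dots> = (\<Sum>x\<in>X. \<phi> x * (\<Sum>i\<in>I. k x i * F i))"
    by (subst sum.swap) (simp add: sum_distrib_left mult_ac)
  finally have "(\<Sum>i\<in>I. (F i)\<^sup>2)\<^sup>2 \<le> (\<Sum>x\<in>X. (\<phi> x)\<^sup>2) * (\<Sum>x\<in>X. (\<Sum>i\<in>I. k x i * F i)\<^sup>2)"
    by (simp only: Cauchy_Schwarz_ineq_sum)
  also have "\<dots> \<le> (\<Sum>x\<in>X. (\<phi> x)\<^sup>2) * (L * (\<Sum>i\<in>I. (F i)\<^sup>2))"
    by (intro mult_left_mono adj) (simp add: sum_nonneg)
  finally have "(\<Sum>i\<in>I. (F i)\<^sup>2) * (\<Sum>i\<in>I. (F i)\<^sup>2) \<le> (L * (\<Sum>x\<in>X. (\<phi> x)\<^sup>2)) * (\<Sum>i\<in>I. (F i)\<^sup>2)"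
    by (simp add: power2_eq_square mult_ac)
  then show ?thesis using pos by (simp only: mult_le_cancel_right_pos)
qed

text \<open>The kernel of an equivalence relation is positive semidefinite: the form is the sum of
  the squared class sums.\<close>

lemma sum_same_class_nonneg:
  fixes F :: "'i::finite \<Rightarrow> real"
  shows "0 \<le> (\<Sum>i\<in>UNIV. \<Sum>j\<in>UNIV. F i * F j * of_bool (c i = c j))"
proof -
  have "(\<Sum>y\<in>range c. (of_bool (c i = y) * of_bool (c j = y) :: real)) = of_bool (c i = c j)" for i j
  proof -
    have "(of_bool (c i = y) * of_bool (c j = y) :: real) = (if y = c i then of_bool (c i = c j) else 0)" for y
      by auto
    then show ?thesis by simp
  qed
  then have "(\<Sum>i\<in>UNIV. \<Sum>j\<in>UNIV. F i * F j * of_bool (c i = c j)) =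
      (\<Sum>y\<in>range c. (\<Sum>i\<in>UNIV. of_bool (c i = y) * F i)\<^sup>2)"
    by (simp only: sum_square_gram)
  then show ?thesis by (simp add: sum_nonneg)
qed

section \<open>Lifts of functions of mean zero to cells\<close>

context power_classes
begin

text \<open>The transpose of the incidence operator between matrices and cells, restricted to one
  determinant class.\<close>

definition lift :: "'a \<Rightarrow> ('a^2^2 \<Rightarrow> real) \<Rightarrow> ('a^2) \<times> ('a^2) \<Rightarrow> real" where
  "lift n \<phi> i = (\<Sum>x\<in>det_class n. \<phi> x * of_bool (sim (x *v fst i) (snd i)))"

text \<open>Cells with a zero vector are empty, so later sums can run over all pairs.\<close>

lemma lift_zero [simp]: "lift n \<phi> (0, w) = 0" "lift n \<phi> (v, 0) = 0"
  unfolding lift_def by (intro sum.neutral; use sim_nz in force)+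

lemma lift_nz:
  assumes "lift n \<phi> (v, w) \<noteq> 0"
  shows "v \<noteq> 0" "w \<noteq> 0"
  using assms by auto

lemma lift_cell_eq: "cell_eq i j \<Longrightarrow> lift n \<phi> j = lift n \<phi> i"
  by (auto simp: lift_def cell_eq_def vector_scalar_commute sim_scale_iff)

text \<open>Each \<open>x\<close> in the class is invertible, hence lies in exactly \<open>m\<close>
  of the cells \<open>(v, w)\<close>. For \<open>\<phi>\<close> of mean zero the row sums of the
  lift therefore vanish.\<close>

lemma sum_lift_right:
  fixes \<phi> :: "'a^2^2 \<Rightarrow> real"
  assumes "n \<in> N" "v \<noteq> 0"
  shows "(\<Sum>w\<in>UNIV. lift n \<phi> (v, w)) = m * (\<Sum>x\<in>det_class n. \<phi> x)"
proof -
  have "(\<Sum>w\<in>UNIV. of_bool (sim (x *v v) w)) = real m" if "x \<in> det_class n" for x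
  proof -
    have "det x \<noteq> 0" using that assms N_nz[of n] by (auto simp: det_class_def)
    then have "x *v v \<noteq> 0"
      using assms(2) by (metis invertible_det_nz inj_matrix_vector_mult matrix_vector_mult_0_right injD)
    then show ?thesis by (simp add: sum_of_bool card_sim')
  qed
  then show ?thesis
    unfolding lift_def fst_conv snd_conv
    by (subst sum.swap) (simp add: sum_distrib_right mult.commute flip: sum_distrib_left)
qed

lemma sum_lift_left:
  fixes \<phi> :: "'a^2^2 \<Rightarrow> real"
  assumes "n \<in> N" "w \<noteq> 0"
  shows "(\<Sum>v\<in>UNIV. lift n \<phi> (v, w)) = m * (\<Sum>x\<in>det_class n. \<phi> x)"
proof -
  have "(\<Sum>v\<in>UNIV. of_bool (sim (x *v v) w)) = real m" if "x \<in> det_class n" for x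
  proof -
    have "det x \<noteq> 0" using that assms N_nz[of n] by (auto simp: det_class_def)
    then have "inj ((*v) x)"
      using inj_matrix_vector_mult invertible_det_nz by blast
    then have "bij ((*v) x)" by (simp add: inj_imp_bij_card)
    then have "card {v. sim (x *v v) w} = m"
      using card_Collect_bij[of "(*v) x" "\<lambda>u. sim u w"] card_sim assms by simp
    then show ?thesis by (simp add: sum_of_bool)
  qed
  then show ?thesis
    unfolding lift_def fst_conv snd_conv
    by (subst sum.swap) (simp add: sum_distrib_right mult.commute flip: sum_distrib_left)
qed

context
  fixes n :: 'a and \<phi> :: "'a^2^2 \<Rightarrow> real"
  assumes n: "n \<in> N" and sum_zero: "(\<Sum>x\<in>det_class n. \<phi> x) = 0"
begin

abbreviation (input) F where "F \<equiv> lift n \<phi>"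

lemma sum_F_right: "(\<Sum>w\<in>UNIV. F (v, w)) = 0"
  using sum_lift_right[OF n, of v \<phi>] sum_zero by (cases "v = 0") auto

lemma sum_F_left: "(\<Sum>v\<in>UNIV. F (v, w)) = 0"
  using sum_lift_left[OF n, of w \<phi>] sum_zero by (cases "w = 0") auto

text \<open>The kernel ignores the second component of \<open>j\<close>, and summing
  \<open>F j\<close> over that component gives a row sum, which is zero.\<close>

lemma sum_F_fst_kernel: "(\<Sum>i\<in>UNIV. \<Sum>j\<in>UNIV. F i * F j * g (fst i) (fst j)) = 0"
proof -
  have "(\<Sum>j\<in>UNIV. F i * F j * g (fst i) (fst j)) = 0" for i
  proof -
    have "(\<Sum>w\<in>UNIV. F i * F (v, w) * g (fst i) v) = F i * g (fst i) v * (\<Sum>w\<in>UNIV. F (v, w))" for v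
      by (simp add: sum_distrib_left mult_ac)
    then show ?thesis
      unfolding sum_UNIV_pair[of "\<lambda>j. F i * F j * g (fst i) (fst j)"] fst_conv
      by (simp add: sum_F_right)
  qed
  then show ?thesis by simp
qed

lemma sum_F_snd_kernel: "(\<Sum>i\<in>UNIV. \<Sum>j\<in>UNIV. F i * F j * g (snd i) (snd j)) = 0"
proof -
  have "(\<Sum>j\<in>UNIV. F i * F j * g (snd i) (snd j)) = 0" for i
  proof -
    have "(\<Sum>v\<in>UNIV. F i * F (v, w) * g (snd i) w) = F i * g (snd i) w * (\<Sum>v\<in>UNIV. F (v, w))" for w
      by (simp add: sum_distrib_left mult_ac)
    then show ?thesis
      unfolding sum_UNIV_pair[of "\<lambda>j. F i * F j * g (snd i) (snd j)"] snd_conv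
      by (subst sum.swap) (simp add: sum_F_left)
  qed
  then show ?thesis by simp
qed

text \<open>\<open>F\<close> is constant on the \<open>(q - 1) * m\<close> pairs that describe one
  cell.\<close>

lemma sum_F_cell_eq:
  "(\<Sum>i\<in>UNIV. \<Sum>j\<in>UNIV. F i * F j * of_bool (cell_eq i j)) = (real q - 1) * m * (\<Sum>i\<in>UNIV. (F i)\<^sup>2)"
proof -
  have q1: "q \<ge> 1" using q_eq by simp
  have "(\<Sum>j\<in>UNIV. F i * F j * of_bool (cell_eq i j)) = (real q - 1) * m * (F i)\<^sup>2" for i
  proof (cases "F i = 0")
    case False
    obtain v w where i: "i = (v, w)" by (cases i)
    have "(\<Sum>j\<in>UNIV. F i * F j * of_bool (cell_eq i j)) = (\<Sum>j\<in>UNIV. (F i)\<^sup>2 * of_bool (cell_eq i j))"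
    proof (rule sum.cong[OF refl])
      show "F i * F j * of_bool (cell_eq i j) = (F i)\<^sup>2 * of_bool (cell_eq i j)" for j
        using lift_cell_eq[of i j n \<phi>] by (cases "cell_eq i j") (simp_all add: power2_eq_square)
    qed
    also have "\<dots> = (F i)\<^sup>2 * card {j. cell_eq i j}"
      by (simp add: sum_of_bool flip: sum_distrib_left)
    also have "card {j. cell_eq i j} = (q - 1) * m"
      using card_cell_eq lift_nz False i by blast
    finally show ?thesis using q1 by (simp add: of_nat_diff)
  qed simp
  then show ?thesis by (simp add: sum_distrib_left)
qed

text \<open>Being parallel in both components is an equivalence relation on pairs of nonzero
  vectors, and \<open>F\<close> vanishes on all other pairs.\<close>

lemma sum_F_parallel_nonneg:
  "0 \<le> (\<Sum>i\<in>UNIV. \<Sum>j\<in>UNIV. F i * F j *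
      of_bool (bracket (fst i) (fst j) = 0 \<and> bracket (snd i) (snd j) = 0))"
proof -
  \<comment> \<open>A line is encoded by the set of vectors whose bracket with it is zero.\<close>
  define c where "c i = ({u. bracket u (fst i) = 0}, {u. bracket u (snd i) = 0})" for i :: "('a^2) \<times> ('a^2)"
  have iff: "bracket v v' = 0 \<longleftrightarrow> {u. bracket u v = 0} = {u. bracket u v' = 0}"
    if nz: "v \<noteq> 0" "v' \<noteq> 0" for v v' :: "'a^2"
  proof
    assume "bracket v v' = 0"
    then obtain b where b: "v' = b *s v" using nz(1) by (rule bracket_eq_zeroE)
    then have "b \<noteq> 0" using nz(2) by auto
    then show "{u. bracket u v = 0} = {u. bracket u v' = 0}" by (simp add: b)
  next
    assume "{u. bracket u v = 0} = {u. bracket u v' = 0}"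
    moreover have "v \<in> {u. bracket u v = 0}" by simp
    ultimately show "bracket v v' = 0" by blast
  qed
  have "F i * F j * of_bool (bracket (fst i) (fst j) = 0 \<and> bracket (snd i) (snd j) = 0) =
      F i * F j * of_bool (c i = c j)" for i j
  proof (cases "F i = 0 \<or> F j = 0")
    case False
    then have "fst i \<noteq> 0" "snd i \<noteq> 0" "fst j \<noteq> 0" "snd j \<noteq> 0"
      using lift_nz[of n \<phi> "fst i" "snd i"] lift_nz[of n \<phi> "fst j" "snd j"] by simp_all
    then have "bracket (fst i) (fst j) = 0 \<and> bracket (snd i) (snd j) = 0 \<longleftrightarrow> c i = c j"
      unfolding c_def prod.inject by (intro conj_cong iff)
    then show ?thesis by (simp only:)
  qed auto
  then show ?thesis using sum_same_class_nonneg[of F c] by (simp only:)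
qed

text \<open>Of the five terms of \<open>card_two_transversals\<close>, the first three vanish by the
  row and column sums, the fourth gives exactly the stated constant, and the fifth subtracts a
  nonnegative form.\<close>

lemma sum_square_transversal_F:
  "(\<Sum>i\<in>UNIV. (\<Sum>j\<in>UNIV. of_bool (transversal n i j) * F j)\<^sup>2) \<le>
    (q * m * (real q - 1))\<^sup>2 * (\<Sum>i\<in>UNIV. (F i)\<^sup>2)"
proof -
  let ?S = "\<lambda>k. \<Sum>i\<in>UNIV. \<Sum>j\<in>UNIV. F i * F j * k i j"
  have expand: "b * (c1 + c2 * x + c3 * y + c4 * z - c5 * w) =
      c1 * (b * 1) + c2 * (b * x) + c3 * (b * y) + c4 * (b * z) - c5 * (b * w)"
    for b c1 c2 c3 c4 c5 x y z w :: real
    by (simp add: algebra_simps)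
  have kernel: "F i * F j * (\<Sum>x\<in>UNIV. of_bool (transversal n x i) * of_bool (transversal n x j)) =
      (real q - 1)\<^sup>2 * m\<^sup>2 * (F i * F j * 1)
      + (real q - 1) * m\<^sup>2 * (F i * F j * of_bool (bracket (fst i) (fst j) = 0))
      + (real q - 1) * m\<^sup>2 * (F i * F j * of_bool (bracket (snd i) (snd j) = 0))
      + q\<^sup>2 * m * (real q - 1) * (F i * F j * of_bool (cell_eq i j))
      - ((real q)\<^sup>2 - 1) * m\<^sup>2 *
        (F i * F j * of_bool (bracket (fst i) (fst j) = 0 \<and> bracket (snd i) (snd j) = 0))"
    for i j
  proof (cases "F i = 0 \<or> F j = 0")
    case False
    obtain v' w' v'' w'' where ij: "i = (v', w')" "j = (v'', w'')" by (cases i, cases j)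
    then have nz: "v' \<noteq> 0" "w' \<noteq> 0" "v'' \<noteq> 0" "w'' \<noteq> 0" using False lift_nz by blast+
    have "(\<Sum>x\<in>UNIV. of_bool (transversal n x i) * of_bool (transversal n x j)) =
        real (card {(v, w). transversal n (v, w) (v', w') \<and> transversal n (v, w) (v'', w'')})"
      by (simp add: sum_of_bool ij split_def flip: of_bool_conj)
    then show ?thesis
      unfolding card_two_transversals[OF n nz] ij fst_conv snd_conv by (simp only: expand)
  qed auto
  have "(\<Sum>i\<in>UNIV. (\<Sum>j\<in>UNIV. of_bool (transversal n i j) * F j)\<^sup>2) =
      (real q - 1)\<^sup>2 * m\<^sup>2 * ?S (\<lambda>i j. 1)
      + (real q - 1) * m\<^sup>2 * ?S (\<lambda>i j. of_bool (bracket (fst i) (fst j) = 0))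
      + (real q - 1) * m\<^sup>2 * ?S (\<lambda>i j. of_bool (bracket (snd i) (snd j) = 0))
      + q\<^sup>2 * m * (real q - 1) * ?S (\<lambda>i j. of_bool (cell_eq i j))
      - ((real q)\<^sup>2 - 1) * m\<^sup>2 *
        ?S (\<lambda>i j. of_bool (bracket (fst i) (fst j) = 0 \<and> bracket (snd i) (snd j) = 0))"
    unfolding sum_square_gram kernel
    by (simp only: sum.distrib sum_subtractf flip: sum_distrib_left)
  also have "?S (\<lambda>i j. 1) = 0" using sum_F_fst_kernel[of "\<lambda>_ _. 1"] by simp
  also have "?S (\<lambda>i j. of_bool (bracket (fst i) (fst j) = 0)) = 0" by (rule sum_F_fst_kernel)
  also have "?S (\<lambda>i j. of_bool (bracket (snd i) (snd j) = 0)) = 0" by (rule sum_F_snd_kernel)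
  also have "?S (\<lambda>i j. of_bool (cell_eq i j)) = (real q - 1) * m * (\<Sum>i\<in>UNIV. (F i)\<^sup>2)"
    by (rule sum_F_cell_eq)
  finally have "(\<Sum>i\<in>UNIV. (\<Sum>j\<in>UNIV. of_bool (transversal n i j) * F j)\<^sup>2) =
      (q * m * (real q - 1))\<^sup>2 * (\<Sum>i\<in>UNIV. (F i)\<^sup>2)
      - ((real q)\<^sup>2 - 1) * m\<^sup>2 *
        ?S (\<lambda>i j. of_bool (bracket (fst i) (fst j) = 0 \<and> bracket (snd i) (snd j) = 0))"
    by (simp add: power_mult_distrib power2_eq_square algebra_simps)
  moreover have "0 \<le> ((real q)\<^sup>2 - 1) * m\<^sup>2" using q_eq by simp
  ultimately show ?thesis using sum_F_parallel_nonneg by simp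
qed

lemma sum_F_transversal:
  "(\<Sum>i\<in>UNIV. \<Sum>j\<in>UNIV. F i * F j * of_bool (transversal n i j)) \<le>
    q * m * (real q - 1) * (\<Sum>i\<in>UNIV. (F i)\<^sup>2)" (is "?L \<le> ?b * ?F")
proof -
  have b: "0 \<le> ?b" using q_eq by simp
  have F: "0 \<le> ?F" by (simp add: sum_nonneg)
  have "?L = (\<Sum>i\<in>UNIV. F i * (\<Sum>j\<in>UNIV. of_bool (transversal n i j) * F j))"
    by (simp only: sum_distrib_left mult_ac)
  then have "?L\<^sup>2 \<le> ?F * (\<Sum>i\<in>UNIV. (\<Sum>j\<in>UNIV. of_bool (transversal n i j) * F j)\<^sup>2)"
    by (simp only: Cauchy_Schwarz_ineq_sum)
  also have "\<dots> \<le> ?F * (?b\<^sup>2 * ?F)"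
    by (intro mult_left_mono F sum_square_transversal_F)
  also have "\<dots> = (?b * ?F)\<^sup>2" by (simp add: power2_eq_square mult_ac)
  finally show ?thesis using b F by (meson mult_nonneg_nonneg power2_le_imp_le)
qed

text \<open>The Gram operator is \<open>m\<^sup>2\<close> times the transversal kernel plus
  \<open>q * m\<^sup>2\<close> times that of \<open>cell_eq\<close>. Each contributes at most
  \<open>q * m ^ 3 * (q - 1)\<close>, whence the factor \<open>2\<close>.\<close>

lemma sum_square_lift_le:
  "(\<Sum>i\<in>UNIV. (F i)\<^sup>2) \<le> 2 * q * m ^ 3 * (real q - 1) * (\<Sum>x\<in>det_class n. (\<phi> x)\<^sup>2)"
proof (rule sum_square_le_of_adjoint)
  let ?k = "\<lambda>x i. of_bool (sim (x *v fst i) (snd i)) :: real"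
  show "F i = (\<Sum>x\<in>det_class n. \<phi> x * ?k x i)" for i by (simp add: lift_def)
  have kernel: "F i * F j * (\<Sum>x\<in>det_class n. ?k x i * ?k x j) =
      m\<^sup>2 * (F i * F j * of_bool (transversal n i j)) + q * m\<^sup>2 * (F i * F j * of_bool (cell_eq i j))"
    for i j
  proof (cases "F i = 0 \<or> F j = 0")
    case False
    obtain v w v' w' where ij: "i = (v, w)" "j = (v', w')" by (cases i, cases j)
    then have nz: "v \<noteq> 0" "w \<noteq> 0" "v' \<noteq> 0" "w' \<noteq> 0" using False lift_nz by blast+
    have "(\<Sum>x\<in>det_class n. ?k x i * ?k x j) =
        real (card {x \<in> det_class n. sim (x *v v) w \<and> sim (x *v v') w'})"
      by (simp only: ij fst_conv snd_conv sum_of_bool finite flip: of_bool_conj)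
    then show ?thesis
      unfolding card_two_cells[OF n nz] by (simp add: ij algebra_simps)
  qed auto
  have "(\<Sum>x\<in>det_class n. (\<Sum>i\<in>UNIV. ?k x i * F i)\<^sup>2) =
      m\<^sup>2 * (\<Sum>i\<in>UNIV. \<Sum>j\<in>UNIV. F i * F j * of_bool (transversal n i j))
      + q * m\<^sup>2 * (\<Sum>i\<in>UNIV. \<Sum>j\<in>UNIV. F i * F j * of_bool (cell_eq i j))"
    unfolding sum_square_gram kernel
    by (simp only: sum.distrib flip: sum_distrib_left)
  also have "\<dots> \<le> m\<^sup>2 * (q * m * (real q - 1) * (\<Sum>i\<in>UNIV. (F i)\<^sup>2))
      + q * m\<^sup>2 * ((real q - 1) * m * (\<Sum>i\<in>UNIV. (F i)\<^sup>2))"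
    unfolding sum_F_cell_eq by (intro add_right_mono mult_left_mono sum_F_transversal) simp
  finally show "(\<Sum>x\<in>det_class n. (\<Sum>i\<in>UNIV. ?k x i * F i)\<^sup>2) \<le>
      2 * q * m ^ 3 * (real q - 1) * (\<Sum>i\<in>UNIV. (F i)\<^sup>2)"
    by (simp add: power2_eq_square power3_eq_cube algebra_simps)
  show "0 \<le> 2 * q * m ^ 3 * (real q - 1)" using q_eq by simp
qed

end

end

subsection \<open>Mixing of determinant classes\<close>

lemma sum_off_diagonal:
  fixes f :: "'i \<Rightarrow> real"
  assumes "finite N"
  shows "(\<Sum>(n, n')\<in>(SIGMA n:N. N - {n}). f n) = (real (card N) - 1) * (\<Sum>n\<in>N. f n)"
    and "(\<Sum>(n, n')\<in>(SIGMA n:N. N - {n}). f n') = (real (card N) - 1) * (\<Sum>n\<in>N. f n)"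
proof -
  have c: "real (card (N - {n})) = real (card N) - 1" if "n \<in> N" for n
  proof -
    have "card N > 0" using that assms card_gt_0_iff by blast
    then show ?thesis using that assms by (simp add: of_nat_diff Suc_leI)
  qed
  have "(\<Sum>(n, n')\<in>(SIGMA n:N. N - {n}). f n) = (\<Sum>n\<in>N. \<Sum>n'\<in>N - {n}. f n)"
    using assms by (subst sum.Sigma) auto
  also have "\<dots> = (\<Sum>n\<in>N. (real (card N) - 1) * f n)"
    using c by (intro sum.cong) (simp_all only: sum_constant)
  finally show 1: "(\<Sum>(n, n')\<in>(SIGMA n:N. N - {n}). f n) = (real (card N) - 1) * (\<Sum>n\<in>N. f n)"
    by (simp add: sum_distrib_left)
  have "(\<Sum>(n, n')\<in>(SIGMA n:N. N - {n}). f n') = (\<Sum>(n, n')\<in>(SIGMA n:N. N - {n}). f n)"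
    by (rule sum.reindex_bij_witness[of _ prod.swap prod.swap]) auto
  then show "(\<Sum>(n, n')\<in>(SIGMA n:N. N - {n}). f n') = (real (card N) - 1) * (\<Sum>n\<in>N. f n)"
    using 1 by simp
qed

lemma Cauchy_Schwarz_sqrt:
  fixes f g :: "'i \<Rightarrow> real"
  shows "(\<Sum>i\<in>I. f i * g i) \<le> sqrt (\<Sum>i\<in>I. (f i)\<^sup>2) * sqrt (\<Sum>i\<in>I. (g i)\<^sup>2)"
  using real_le_rsqrt[OF Cauchy_Schwarz_ineq_sum[of f g I]] by (simp add: real_sqrt_mult)

text \<open>By \<open>mix\<close>, the off-diagonal part of the product is at most
  \<open>sqrt (\<sigma> - S) * sqrt (\<tau> - T)\<close>, where \<open>S\<close> and
  \<open>T\<close> are the sums of squares; the diagonal part is at most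
  \<open>sqrt S * sqrt T\<close>. Together they give
  \<open>\<sigma> * \<tau> \<le> sqrt (\<sigma> * \<tau>)\<close>, which forces the claim.\<close>

lemma sum_mult_sum_le_one:
  fixes s t :: "'i \<Rightarrow> real"
  assumes N: "finite N" "2 \<le> card N"
    and s: "\<And>n. n \<in> N \<Longrightarrow> 0 \<le> s n \<and> s n \<le> 1" and t: "\<And>n. n \<in> N \<Longrightarrow> 0 \<le> t n \<and> t n \<le> 1"
    and mix: "\<And>n n'. n \<in> N \<Longrightarrow> n' \<in> N \<Longrightarrow> n \<noteq> n' \<Longrightarrow>
      (real (card N) - 1) * (s n * t n') \<le> sqrt (s n * (1 - s n)) * sqrt (t n' * (1 - t n'))"
  shows "(\<Sum>n\<in>N. s n) * (\<Sum>n\<in>N. t n) \<le> 1"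
proof -
  define S where "S = (\<Sum>n\<in>N. (s n)\<^sup>2)"
  define T where "T = (\<Sum>n\<in>N. (t n)\<^sup>2)"
  define \<sigma> where "\<sigma> = (\<Sum>n\<in>N. s n)"
  define \<tau> where "\<tau> = (\<Sum>n\<in>N. t n)"
  define P where "P = (SIGMA n:N. N - {n})"
  define c where "c = real (card N) - 1"
  have c: "c > 0" using N by (simp add: c_def)
  have sn: "0 \<le> s n * (1 - s n)" and tn: "0 \<le> t n * (1 - t n)" if "n \<in> N" for n
    using s[OF that] t[OF that] by simp_all
  have VS: "(\<Sum>n\<in>N. s n * (1 - s n)) = \<sigma> - S" and VT: "(\<Sum>n\<in>N. t n * (1 - t n)) = \<tau> - T"
    by (simp_all add: \<sigma>_def \<tau>_def S_def T_def sum_subtractf power2_eq_square right_diff_distrib)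
  have pos: "0 \<le> \<sigma> - S" "0 \<le> \<tau> - T"
    unfolding VS[symmetric] VT[symmetric] by (auto intro: sum_nonneg sn tn)
  have pos': "0 \<le> S" "0 \<le> T" "0 \<le> \<sigma>" "0 \<le> \<tau>"
    unfolding S_def T_def \<sigma>_def \<tau>_def using s t by (auto intro: sum_nonneg)
  have off: "(\<Sum>(n, n')\<in>P. s n * t n') = \<sigma> * \<tau> - (\<Sum>n\<in>N. s n * t n)"
  proof -
    have "(\<Sum>(n, n')\<in>P. s n * t n') = (\<Sum>n\<in>N. \<Sum>n'\<in>N - {n}. s n * t n')"
      unfolding P_def using N by (subst sum.Sigma) auto
    also have "\<dots> = (\<Sum>n\<in>N. s n * \<tau> - s n * t n)"
    proof (rule sum.cong[OF refl])
      fix n assume "n \<in> N"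
      then have "(\<Sum>n'\<in>N - {n}. t n') = \<tau> - t n" using N by (simp add: sum_diff1 \<tau>_def)
      then show "(\<Sum>n'\<in>N - {n}. s n * t n') = s n * \<tau> - s n * t n"
        by (simp add: right_diff_distrib flip: sum_distrib_left)
    qed
    finally show ?thesis by (simp add: sum_subtractf \<sigma>_def sum_distrib_right)
  qed
  have "c * (\<Sum>(n, n')\<in>P. s n * t n') \<le>
      (\<Sum>(n, n')\<in>P. sqrt (s n * (1 - s n)) * sqrt (t n' * (1 - t n')))"
    unfolding sum_distrib_left P_def c_def using mix by (intro sum_mono) auto
  also have "\<dots> \<le> sqrt (\<Sum>(n, n')\<in>P. (sqrt (s n * (1 - s n)))\<^sup>2) * sqrt (\<Sum>(n, n')\<in>P. (sqrt (t n' * (1 - t n')))\<^sup>2)"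
    using Cauchy_Schwarz_sqrt[of "\<lambda>(n, n'). sqrt (s n * (1 - s n))" "\<lambda>(n, n'). sqrt (t n' * (1 - t n'))" P]
    by (simp add: split_def)
  \<comment> \<open>Each index occurs in \<open>c\<close> off-diagonal pairs; this factor cancels
    the one that \<open>mix\<close> carries on the left.\<close>
  also have "(\<Sum>(n, n')\<in>P. (sqrt (s n * (1 - s n)))\<^sup>2) = c * (\<sigma> - S)"
    unfolding P_def sum_off_diagonal(1)[OF N(1)] c_def VS[symmetric] by (simp add: sn)
  also have "(\<Sum>(n, n')\<in>P. (sqrt (t n' * (1 - t n')))\<^sup>2) = c * (\<tau> - T)"
    unfolding P_def sum_off_diagonal(2)[OF N(1)] c_def VT[symmetric] by (simp add: tn)
  also have "sqrt (c * (\<sigma> - S)) * sqrt (c * (\<tau> - T)) = c * (sqrt (\<sigma> - S) * sqrt (\<tau> - T))"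
    using c by (simp add: real_sqrt_mult)
  finally have "\<sigma> * \<tau> \<le> (\<Sum>n\<in>N. s n * t n) + sqrt (\<sigma> - S) * sqrt (\<tau> - T)"
    using c off by simp
  also have "\<dots> \<le> sqrt S * sqrt T + sqrt (\<sigma> - S) * sqrt (\<tau> - T)"
    unfolding S_def T_def by (intro add_right_mono Cauchy_Schwarz_sqrt)
  also have "\<dots> \<le> sqrt (\<sigma> * \<tau>)"
  proof -
    \<comment> \<open>Cauchy-Schwarz for two summands, with the Booleans as index set.\<close>
    have "sqrt S * sqrt T + sqrt (\<sigma> - S) * sqrt (\<tau> - T) \<le>
        sqrt ((sqrt S)\<^sup>2 + (sqrt (\<sigma> - S))\<^sup>2) * sqrt ((sqrt T)\<^sup>2 + (sqrt (\<tau> - T))\<^sup>2)"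
      using Cauchy_Schwarz_sqrt[of "\<lambda>b. if b then sqrt S else sqrt (\<sigma> - S)"
          "\<lambda>b. if b then sqrt T else sqrt (\<tau> - T)" UNIV]
      by (simp add: UNIV_bool add.commute)
    then show ?thesis using pos pos' by (simp add: real_sqrt_mult)
  qed
  finally have le: "\<sigma> * \<tau> \<le> sqrt (\<sigma> * \<tau>)" .
  have "\<sigma> * \<tau> \<le> 1"
  proof (rule ccontr)
    assume gt: "\<not> \<sigma> * \<tau> \<le> 1"
    then have "\<sigma> * \<tau> < (\<sigma> * \<tau>)\<^sup>2"
      using power_strict_increasing[of 1 2 "\<sigma> * \<tau>"] by simp
    then have "sqrt (\<sigma> * \<tau>) < \<sigma> * \<tau>" using gt by (intro real_less_lsqrt) auto
    then show False using le by simp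
  qed
  then show ?thesis by (simp add: \<sigma>_def \<tau>_def)
qed

context power_classes
begin

definition density :: "('a^2^2) set \<Rightarrow> 'a \<Rightarrow> real" where
  "density A n = card (A \<inter> det_class n) / class_size"

lemma q_ge_3: "q \<ge> 3"
proof -
  have "l \<ge> 1" using prime_l prime_ge_1_nat by blast
  then have "1 * 2 \<le> l * m" by (intro mult_le_mono m_ge_2)
  then show ?thesis using q_eq by simp
qed

lemma real_class_size: "real class_size = ((real q)\<^sup>2 - 1) * (m * q)"
  unfolding class_size_def using q_ge_3 by (simp add: of_nat_diff)

lemma class_size_pos: "0 < class_size"
proof -
  have "1 < q\<^sup>2" using q_ge_3 by (intro one_less_power) auto
  then show ?thesis unfolding class_size_def using q_ge_3 m_pos by simp
qed

lemma density_bounds: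
  assumes "n \<in> N"
  shows "0 \<le> density A n" "density A n \<le> 1"
proof -
  have "card (A \<inter> det_class n) \<le> card (det_class n)" by (intro card_mono) auto
  then show "density A n \<le> 1"
    using class_size_pos card_det_class[OF assms] by (simp add: density_def)
qed (simp add: density_def)

text \<open>The centred indicator has mean zero, as the spectral bound requires; its squared norm is
  a Bernoulli variance times the class size.\<close>

lemma sum_indicator_minus_density:
  assumes "n \<in> N"
  shows "(\<Sum>x\<in>det_class n. indicator A x - density A n) = 0"
    and "(\<Sum>x\<in>det_class n. (indicator A x - density A n)\<^sup>2) =
      class_size * (density A n * (1 - density A n))"
proof -
  have ind: "(\<Sum>x\<in>det_class n. indicator A x) = class_size * density A n"
    using class_size_pos
    by (simp add: density_def indicator_def Int_commute flip: Int_def of_bool_def)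
  have c: "card (det_class n) = class_size"
    by (rule card_det_class[OF assms])
  show "(\<Sum>x\<in>det_class n. indicator A x - density A n) = 0"
    by (simp add: sum_subtractf ind c)
  have "(indicator A x - density A n)\<^sup>2 = indicator A x * (1 - 2 * density A n) + (density A n)\<^sup>2" for x
    by (simp add: indicator_def power2_eq_square algebra_simps)
  then have "(\<Sum>x\<in>det_class n. (indicator A x - density A n)\<^sup>2) =
      class_size * density A n * (1 - 2 * density A n) + class_size * (density A n)\<^sup>2"
    by (simp add: sum.distrib ind c flip: sum_distrib_right)
  then show "(\<Sum>x\<in>det_class n. (indicator A x - density A n)\<^sup>2) =
      class_size * (density A n * (1 - density A n))"
    by (simp add: power2_eq_square algebra_simps)
qed

text \<open>Every cell of nonzero vectors has \<open>q * m\<^sup>2\<close> matrices in the class, so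
  the constant part of the indicator has a constant lift there.\<close>

lemma lift_indicator:
  assumes "n \<in> N"
  shows "lift n (indicator A) (v, w) =
    lift n (\<lambda>x. indicator A x - density A n) (v, w) + density A n * (q * m\<^sup>2) * of_bool (v \<noteq> 0 \<and> w \<noteq> 0)"
proof (cases "v \<noteq> 0 \<and> w \<noteq> 0")
  case True
  have "lift n (\<lambda>x. indicator A x - density A n) (v, w) =
      lift n (indicator A) (v, w) - density A n * (\<Sum>x\<in>det_class n. of_bool (sim (x *v v) w))"
    by (simp only: lift_def left_diff_distrib sum_subtractf sum_distrib_left fst_conv snd_conv)
  also have "(\<Sum>x\<in>det_class n. of_bool (sim (x *v v) w)) = real (q * m\<^sup>2)"
    using card_block[OF assms, of v w] True unfolding sum_of_bool[OF finite] by simp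
  finally show ?thesis using True by simp
qed auto

text \<open>By \<open>disjoint\<close>, the lifts of the two indicators, one twisted by
  \<open>a\<close>, have disjoint supports. After splitting each into a constant and a centred part,
  the cross terms sum to zero, so the product of the constants is minus the inner product of the
  centred parts, which \<open>sum_square_lift_le\<close> bounds.\<close>

lemma mixing:
  assumes n: "n \<in> N" "n' \<in> N" and a: "a \<noteq> 0"
    and disjoint: "\<And>x y v w. x \<in> A \<inter> det_class n \<Longrightarrow> y \<in> B \<inter> det_class n' \<Longrightarrow> v \<noteq> 0 \<Longrightarrow>
      sim (x *v v) w \<Longrightarrow> sim (y *v v) (a *s w) \<Longrightarrow> False"
  shows "(real q + 1) * (density A n * density B n') \<le>
    2 * (sqrt (density A n * (1 - density A n)) * sqrt (density B n' * (1 - density B n')))"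
proof -
  define s where "s = density A n"
  define t where "t = density B n'"
  define F where "F = lift n (\<lambda>x. indicator A x - s)"
  \<comment> \<open>The twist by \<open>a\<close> permutes the pairs, so it changes neither sums nor
    norms.\<close>
  define H where "H = (\<lambda>i. lift n' (\<lambda>x. indicator B x - t) (fst i, a *s snd i))"
  define b where "b = real (q * m\<^sup>2)"
  define e where "e i = (of_bool (fst i \<noteq> 0 \<and> snd i \<noteq> 0) :: real)" for i :: "('a^2) \<times> ('a^2)"
  define C where "C = 2 * q * m ^ 3 * (real q - 1)"
  have q1: "real q > 1" using q_ge_3 by simp
  have C: "0 \<le> C" using q1 by (simp add: C_def)
  have bij: "bij (\<lambda>w :: 'a^2. a *s w)"
    by (rule o_bij[of "\<lambda>w. (1 / a) *s w"]) (use a in \<open>auto simp: fun_eq_iff vector_smult_assoc\<close>)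
  have sum_F: "(\<Sum>i\<in>UNIV. F i) = 0"
    unfolding sum_UNIV_pair F_def s_def
    using sum_F_right[OF n(1) sum_indicator_minus_density(1)[OF n(1)]] by simp
  have reindex: "(\<Sum>i\<in>UNIV. f (fst i, a *s snd i)) = (\<Sum>i\<in>UNIV. f i)"
    for f :: "('a^2) \<times> ('a^2) \<Rightarrow> real"
    unfolding sum_UNIV_pair[of "\<lambda>i. f (fst i, a *s snd i)"] sum_UNIV_pair[of f] fst_conv snd_conv
    by (intro sum.cong refl sum.reindex_bij_betw[OF bij])
  have sum_H: "(\<Sum>i\<in>UNIV. H i) = 0"
    unfolding H_def reindex t_def sum_UNIV_pair
    using sum_F_right[OF n(2) sum_indicator_minus_density(1)[OF n(2)]] by simp
  have sq_F: "(\<Sum>i\<in>UNIV. (F i)\<^sup>2) \<le> C * (class_size * (s * (1 - s)))"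
    using sum_square_lift_le[OF n(1) sum_indicator_minus_density(1)[OF n(1)], of A]
    unfolding sum_indicator_minus_density(2)[OF n(1)] by (simp add: F_def C_def s_def)
  have sq_H: "(\<Sum>i\<in>UNIV. (H i)\<^sup>2) \<le> C * (class_size * (t * (1 - t)))"
    using sum_square_lift_le[OF n(2) sum_indicator_minus_density(1)[OF n(2)], of B]
    unfolding sum_indicator_minus_density(2)[OF n(2)] H_def reindex[of "\<lambda>i. (lift n' _ i)\<^sup>2"]
    by (simp add: C_def t_def)
  have eF: "e i * F i = F i" for i
    by (cases i) (auto simp: e_def F_def)
  have eH: "e i * H i = H i" for i
    by (cases i) (auto simp: e_def H_def)
  have prod_zero: "(F i + s * b * e i) * (H i + t * b * e i) = 0" for i
  proof -
    obtain v w where i: "i = (v, w)" by (cases i)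
    have aw: "a *s w \<noteq> 0 \<longleftrightarrow> w \<noteq> 0" using a by (simp add: vector_mul_eq_0)
    have 1: "F i + s * b * e i = lift n (indicator A) (v, w)"
      unfolding lift_indicator[OF n(1)] by (simp add: F_def s_def b_def e_def i)
    have 2: "H i + t * b * e i = lift n' (indicator B) (v, a *s w)"
      unfolding lift_indicator[OF n(2)] aw by (simp add: H_def t_def b_def e_def i)
    show ?thesis
    proof (rule ccontr)
      assume nz: "(F i + s * b * e i) * (H i + t * b * e i) \<noteq> 0"
      then have nz1: "lift n (indicator A) (v, w) \<noteq> 0" and nz2: "lift n' (indicator B) (v, a *s w) \<noteq> 0"
        using 1 2 by auto
      obtain x where x: "x \<in> det_class n" "indicator A x * of_bool (sim (x *v v) w) \<noteq> (0 :: real)"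
        using nz1 unfolding lift_def fst_conv snd_conv by (rule sum.not_neutral_contains_not_neutral)
      obtain y where y: "y \<in> det_class n'" "indicator B y * of_bool (sim (y *v v) (a *s w)) \<noteq> (0 :: real)"
        using nz2 unfolding lift_def fst_conv snd_conv by (rule sum.not_neutral_contains_not_neutral)
      show False
        using disjoint[of x y v w] x y lift_nz(1)[OF nz1] by (auto simp: indicator_def split: if_splits)
    qed
  qed
  have sum_e: "(\<Sum>i\<in>UNIV. (e i)\<^sup>2) = ((real q)\<^sup>2 - 1)\<^sup>2"
  proof -
    have "(\<Sum>i\<in>UNIV. (e i)\<^sup>2) = (\<Sum>i\<in>UNIV. of_bool (i \<in> {v :: 'a^2. v \<noteq> 0} \<times> {w :: 'a^2. w \<noteq> 0}))"
      by (intro sum.cong) (auto simp: e_def)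
    also have "\<dots> = real (card ({v :: 'a^2. v \<noteq> 0} \<times> {w :: 'a^2. w \<noteq> 0}))"
      by (simp only: sum_of_bool finite) simp
    finally show ?thesis
      using q1 by (simp add: card_cartesian_product card_nonzero_vec of_nat_diff power2_eq_square)
  qed
  have "0 = (\<Sum>i\<in>UNIV. (F i + s * b * e i) * (H i + t * b * e i))"
    by (simp add: prod_zero)
  also have "\<dots> = (\<Sum>i\<in>UNIV. F i * H i + t * b * F i + s * b * H i + s * t * b\<^sup>2 * (e i)\<^sup>2)"
  proof (rule sum.cong[OF refl])
    fix i
    have "(F i + s * b * e i) * (H i + t * b * e i) =
        F i * H i + t * b * (e i * F i) + s * b * (e i * H i) + s * t * b\<^sup>2 * (e i)\<^sup>2"
      by (simp add: algebra_simps power2_eq_square)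
    then show "(F i + s * b * e i) * (H i + t * b * e i) =
        F i * H i + t * b * F i + s * b * H i + s * t * b\<^sup>2 * (e i)\<^sup>2"
      by (simp only: eF eH)
  qed
  also have "\<dots> = (\<Sum>i\<in>UNIV. F i * H i) + s * t * b\<^sup>2 * ((real q)\<^sup>2 - 1)\<^sup>2"
    by (simp add: sum.distrib sum_F sum_H sum_e flip: sum_distrib_left)
  finally have "s * t * b\<^sup>2 * ((real q)\<^sup>2 - 1)\<^sup>2 = (\<Sum>i\<in>UNIV. (- F i) * H i)"
    by (simp add: sum_negf)
  also have "\<dots> \<le> sqrt (\<Sum>i\<in>UNIV. (F i)\<^sup>2) * sqrt (\<Sum>i\<in>UNIV. (H i)\<^sup>2)"
    using Cauchy_Schwarz_sqrt[of "\<lambda>i. - F i" H UNIV] by simp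
  also have "\<dots> \<le> sqrt (C * (class_size * (s * (1 - s)))) * sqrt (C * (class_size * (t * (1 - t))))"
  proof (intro mult_mono real_sqrt_le_mono sq_F sq_H real_sqrt_ge_zero)
    have "0 \<le> (\<Sum>i\<in>UNIV. (F i)\<^sup>2)" by (simp add: sum_nonneg)
    then show "0 \<le> C * (class_size * (s * (1 - s)))" using sq_F by linarith
  qed (simp add: sum_nonneg)
  also have "\<dots> = C * class_size * (sqrt (s * (1 - s)) * sqrt (t * (1 - t)))"
    using C unfolding mult.assoc[symmetric, of C] real_sqrt_mult[of "C * class_size"] by simp
  finally have main: "s * t * b\<^sup>2 * ((real q)\<^sup>2 - 1)\<^sup>2 \<le> C * class_size * (sqrt (s * (1 - s)) * sqrt (t * (1 - t)))" .
  \<comment> \<open>The common factor of both sides; cancelling it leaves \<open>q + 1\<close>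
    against \<open>2\<close>.\<close>
  define k where "k = (real q)\<^sup>2 * real m ^ 4 * (real q - 1) * ((real q)\<^sup>2 - 1)"
  have "(real q)\<^sup>2 > 1" using q1 by simp
  then have k: "k > 0" using q1 m_pos by (simp add: k_def)
  have 1: "b\<^sup>2 * ((real q)\<^sup>2 - 1)\<^sup>2 = k * (real q + 1)"
    unfolding b_def k_def of_nat_mult of_nat_power by algebra
  have 2: "C * class_size = k * 2"
    unfolding C_def k_def real_class_size by (simp add: power3_eq_cube power4_eq_xxxx power2_eq_square)
  have "k * ((real q + 1) * (s * t)) = s * t * (b\<^sup>2 * ((real q)\<^sup>2 - 1)\<^sup>2)"
    unfolding 1 by (simp add: mult_ac)
  also have "\<dots> \<le> k * (2 * (sqrt (s * (1 - s)) * sqrt (t * (1 - t))))"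
    using main unfolding 2 by (simp add: mult_ac)
  finally show ?thesis
    using k unfolding s_def t_def by (simp only: mult_le_cancel_left_pos)
qed

end

subsection \<open>Fixed vectors in the principal series\<close>

primrec matpow :: "'a::semiring_1^2^2 \<Rightarrow> nat \<Rightarrow> 'a^2^2" where
  "matpow g 0 = mat 1"
| "matpow g (Suc k) = g ** matpow g k"

lemma matpow_add: "matpow g (i + j) = matpow g i ** matpow g j"
  by (induction i) (simp_all add: matrix_mul_assoc)

lemma matpow_comm: "matpow g k ** g = g ** matpow g k"
  by (metis add.commute matpow.simps matpow_add matrix_mul_rid plus_1_eq_Suc)

lemma det_matpow: "det (matpow (g :: 'a::comm_ring_1^2^2) k) = det g ^ k"
  by (induction k) (simp_all add: det_mul)

lemma matpow_eigenvector: "g *v v = a *s v \<Longrightarrow> matpow (g :: 'a::field^2^2) k *v v = a ^ k *s v"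
  by (induction k)
    (simp_all add: vector_scalar_commute vector_smult_assoc mult.commute flip: matrix_vector_mul_assoc)

abbreviation scalar_mat :: "'a::field \<Rightarrow> 'a^2^2" where
  "scalar_mat c \<equiv> vector [vector [c, 0], vector [0, c]]"

lemma scalar_mat_mult: "scalar_mat c ** x = x ** scalar_mat c"
  by (simp add: vec_eq_iff forall_2 matrix_matrix_mult_def sum_2 mult.commute)

lemma scalar_mat_vec: "scalar_mat c *v v = c *s v"
  by (simp add: vec_eq_iff forall_2 matrix_vector_mult_def sum_2)

lemma det_scalar_mat: "det (scalar_mat c) = c\<^sup>2"
  by (simp add: det_2 power2_eq_square)

text \<open>Functions in the principal series are governed by the bottom row, on which right
  multiplication acts through the transpose.\<close>

lemma row_mult: "((x :: 'a::comm_semiring_1^2^2) ** g) $ i = transpose g *v (x $ i)"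
  by (simp add: vec_eq_iff matrix_matrix_mult_def matrix_vector_mult_def transpose_def mult.commute)

lemma matpow_period:
  fixes g :: "'a::{field, finite}^2^2"
  assumes "det g \<noteq> 0"
  obtains k where "0 < k" "matpow g k = mat 1"
proof -
  have "\<not> inj (matpow g)"
    using finite_imageD[of "matpow g" UNIV] by (auto simp: infinite_UNIV_nat)
  then obtain i j where ij: "i < j" "matpow g i = matpow g j"
    unfolding inj_def by (metis linorder_neqE_nat)
  have "invertible (matpow g i)" using assms by (simp add: invertible_det_nz det_matpow)
  then obtain h where h: "h ** matpow g i = mat 1" by (auto simp: invertible_def)
  have "matpow g i ** matpow g (j - i) = matpow g i"
    using ij matpow_add[of g i "j - i"] by simp
  then have "h ** matpow g i ** matpow g (j - i) = h ** matpow g i"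
    by (metis matrix_mul_assoc)
  then show ?thesis using that[of "j - i"] ij h by simp
qed

lemma fixed_by_matpow:
  assumes "\<And>x. f (x ** g) = f x"
  shows "f (x ** matpow g k) = f x"
  by (induction k arbitrary: x) (simp_all add: assms matrix_mul_assoc)

context power_classes
begin

text \<open>If both eigenvalues of \<open>g\<close> lie in one nontrivial class \<open>z\<close>, then \<open>g\<close> to the power \<open>m * q\<close> is the
  scalar \<open>z\<close>: the exponent \<open>m\<close> equalises the eigenvalues and \<open>q\<close> kills the unipotent part.\<close>

lemma no_fixed_vector:
  assumes v: "v \<noteq> 0" "g *v v = a *s v" and a: "a \<noteq> 0"
    and det: "det g ^ m = (a ^ m)\<^sup>2" and nontrivial: "a ^ m \<noteq> 1"
    and f: "f \<in> principal_series \<epsilon> m" "\<And>x. f (x ** g) = f x"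
  shows "f = 0"
proof -
  define z where "z = a ^ m"
  have z: "z \<in> N" "z \<noteq> 0" using power_m_in_N a by (auto simp: z_def)
  obtain u where u: "bracket v u \<noteq> 0" using ex_bracket_nz v by blast
  obtain b d where gu: "g *v u = b *s v + d *s u" using bracket_expand[OF u] by blast
  \<comment> \<open>In the basis \<open>v\<close>, \<open>u\<close> the matrix is triangular with
    diagonal \<open>a\<close>, \<open>d\<close>, so the determinant condition puts \<open>d\<close>
    into the class \<open>z\<close> too.\<close>
  have "det g * bracket v u = a * d * bracket v u"
    unfolding bracket_mult[symmetric] v(2) gu by (simp add: bracket_add_right)
  then have "det g = a * d" using u by simp
  then have d: "d ^ m = z"
    using det a by (simp add: power_mult_distrib power2_eq_square z_def)
  have "\<exists>c. matpow g k *v u = c *s v + d ^ k *s u" for k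
  proof (induction k)
    case 0
    show ?case by (intro exI[of _ 0]) simp
  next
    case (Suc k)
    then obtain c where c: "matpow g k *v u = c *s v + d ^ k *s u" by blast
    have "matpow g (Suc k) *v u = (c * a + d ^ k * b) *s v + d ^ Suc k *s u"
      by (simp add: c gu v(2) matrix_vector_right_distrib vector_scalar_commute
          vector_smult_assoc vector_add_ldistrib vector_sadd_rdistrib mult.commute
          flip: matrix_vector_mul_assoc)
    then show ?case by blast
  qed
  from this[of m] obtain c where c: "matpow g m *v u = c *s v + z *s u" unfolding d by blast
  define M where "M = matpow g m"
  have Mv: "M *v v = z *s v" and Mu: "M *v u = c *s v + z *s u"
    using matpow_eigenvector[OF v(2)] c by (simp_all add: M_def z_def)
  \<comment> \<open>\<open>M\<close> has the double eigenvalue \<open>z\<close>; the off-diagonal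
    entry of its \<open>k\<close>-th power is a multiple of \<open>k\<close>, hence zero for
    \<open>k = q\<close>.\<close>
  have Mk: "matpow M k *v u = (of_nat k * (c / z) * z ^ k) *s v + z ^ k *s u" for k
  proof (induction k)
    case (Suc k)
    have "matpow M (Suc k) *v u =
        (of_nat k * (c / z) * z ^ k * z + z ^ k * c) *s v + z ^ Suc k *s u"
      by (simp add: Suc Mu Mv matrix_vector_right_distrib vector_scalar_commute
          vector_smult_assoc vector_add_ldistrib vector_sadd_rdistrib mult.commute
          flip: matrix_vector_mul_assoc)
    also have "of_nat k * (c / z) * z ^ k * z + z ^ k * c = of_nat (Suc k) * (c / z) * z ^ Suc k"
      using z by (simp add: field_simps)
    finally show ?case .
  qed simp
  have "z ^ q = z"
    using N_power_l[OF z(1)] by (simp add: q_eq power_mult)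
  moreover have "(of_nat q :: 'a) = 0" using finite_field_of_nat_card[where 'a = 'a] card_q by simp
  ultimately have "matpow M q = scalar_mat z"
    using matrix_eq_on_basis[OF u, of "matpow M q" "scalar_mat z"]
    by (simp add: Mk matpow_eigenvector[OF Mv] scalar_mat_vec)
  moreover have "f (x ** matpow M q) = f x" for x
    unfolding M_def using fixed_by_matpow f(2) by metis
  ultimately have eq: "f (scalar_mat z ** x) = f x" for x by (simp add: scalar_mat_mult)
  \<comment> \<open>The order of \<open>z\<close> divides \<open>l\<close>, which is coprime to
    \<open>m\<close>, so the scalar \<open>z\<close> multiplies \<open>f\<close> by a nontrivial
    factor.\<close>
  have "\<mu> z \<noteq> 1" using mu_eq_one_iff N_power_m_eq_one z nontrivial z_def by metis
  have "f x = 0" for x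
  proof (cases "x \<in> GL2")
    case True
    then have "f (scalar_mat z ** x) = \<mu> z * f x"
      using f(1) z unfolding principal_series_def by blast
    then have "(\<mu> z - 1) * f x = 0" using eq[of x] by (simp add: algebra_simps)
    then show ?thesis using \<open>\<mu> z \<noteq> 1\<close> by simp
  qed (use f(1) in \<open>simp add: principal_series_def\<close>)
  then show ?thesis by (simp add: fun_eq_iff)
qed

text \<open>Such an \<open>r\<close> ensures that the weighted sum over its orbit in
  \<open>ex_fixed_vector\<close> cannot cancel. If \<open>r\<close> and \<open>h *v r\<close> are
  independent, a power of \<open>h\<close> that scales \<open>r\<close> is the scalar
  \<open>c\<close>, with \<open>c\<^sup>2 = det h ^ k\<close>; so the class of \<open>c\<close> has
  square \<open>1\<close> and is trivial, as \<open>l\<close> is odd. If no such \<open>r\<close>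
  exists, \<open>h\<close> is itself a scalar of trivial class.\<close>

lemma ex_good_vector:
  fixes h :: "'a^2^2"
  assumes det: "det h ^ m = 1"
  obtains r where "r \<noteq> 0" "\<And>k c. matpow h k *v r = c *s r \<Longrightarrow> c ^ m = 1"
proof (cases "\<exists>r. bracket r (h *v r) \<noteq> 0")
  case True
  then obtain r where r: "bracket r (h *v r) \<noteq> 0" by blast
  have "c ^ m = 1" if c: "matpow h k *v r = c *s r" for k c
  proof -
    have "matpow h k *v (h *v r) = c *s (h *v r)"
      by (metis c matpow_comm matrix_vector_mul_assoc vector_scalar_commute)
    then have "matpow h k = scalar_mat c"
      using matrix_eq_on_basis[OF r, of "matpow h k" "scalar_mat c"] c by (simp only: scalar_mat_vec)
    then have "c\<^sup>2 = det h ^ k" using det_scalar_mat det_matpow by metis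
    then have "(c ^ m)\<^sup>2 = 1" using det by (metis power_commutes power_mult mult.commute power_one)
    moreover have "c \<noteq> 0" using calculation m_pos by (auto simp: power_0_left)
    ultimately show ?thesis using N_square_eq_one power_m_in_N by blast
  qed
  moreover have "r \<noteq> 0" using r by auto
  ultimately show ?thesis using that by blast
next
  case False
  then have eig: "bracket r (h *v r) = 0" for r by blast
  have "h$2$1 = 0" "h$1$2 = 0" "h$1$1 = h$2$2"
    using eig[of "axis 1 1"] eig[of "axis 2 1"] eig[of "vector [1, 1]"]
    by (simp_all add: bracket_def matrix_vector_mult_def sum_2 axis_def)
  then have h: "h = scalar_mat (h$1$1)" by (simp add: vec_eq_iff forall_2)
  define a where "a = h$1$1"
  have "(a ^ m)\<^sup>2 = 1"
    using det det_scalar_mat[of a] h unfolding a_def by (metis power_mult mult.commute)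
  moreover have "a \<noteq> 0" using calculation m_pos by (auto simp: power_0_left)
  ultimately have am: "a ^ m = 1" using N_square_eq_one power_m_in_N by blast
  have "c ^ m = 1" if "matpow h k *v axis 1 1 = c *s axis 1 1" for k c
  proof -
    have "h *v axis 1 1 = a *s axis 1 1" unfolding a_def by (subst h) (simp add: scalar_mat_vec)
    then have "a ^ k *s axis 1 1 = c *s (axis 1 1 :: 'a^2)" using matpow_eigenvector that by metis
    then have "c = a ^ k" by (simp add: vector_mul_rcancel axis_eq_0_iff)
    then show ?thesis using am by (metis power_commutes power_mult mult.commute power_one)
  qed
  then show ?thesis using that[of "axis 1 1"] by (simp add: axis_eq_0_iff)
qed

text \<open>On \<open>V\<^bsub>m,0\<^esub>\<close> a function is \<open>\<mu> (det x)\<close> times a homogeneous function of the bottom row; the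
  invariant one below is supported on the orbit of a single row.\<close>

lemma ex_fixed_vector:
  assumes det: "det g ^ m = 1"
  obtains f where "f \<in> principal_series \<epsilon> m" "f \<noteq> 0" "\<And>x. f (x ** g) = f x"
proof -
  define h where "h = transpose g"
  have det_h: "det h ^ m = 1" using det by (simp add: h_def)
  then have det_h0: "det h \<noteq> 0" and det_g0: "det g \<noteq> 0" using det by auto
  obtain r where r: "r \<noteq> 0" "\<And>k c. matpow h k *v r = c *s r \<Longrightarrow> c ^ m = 1"
    using ex_good_vector[OF det_h] by blast
  obtain K where K: "0 < K" "matpow h K = mat 1" using matpow_period[OF det_h0] .
  \<comment> \<open>\<open>T k s\<close> is \<open>\<mu> c\<close> if
    \<open>matpow h k *v r = c *s s\<close>, and \<open>0\<close> if there is no such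
    \<open>c\<close>; \<open>H\<close> adds these weights along a period of the orbit of
    \<open>r\<close>.\<close>
  define T where "T k s = (\<Sum>c\<in>UNIV - {0}. \<mu> c * of_bool (matpow h k *v r = c *s s))" for k s
  define H where "H s = (\<Sum>k<K. T k s)" for s
  define f where "f x = (if x \<in> GL2 then \<mu> (det x) * H (x$2) else 0)" for x
  have GL2_iff: "x \<in> GL2 \<longleftrightarrow> det x \<noteq> 0" for x :: "'a^2^2" by (simp add: GL2_def invertible_det_nz)
  have inj: "h *v x = h *v y \<longleftrightarrow> x = y" for x y
    using inj_matrix_vector_mult[of h] det_h0 by (auto simp: invertible_det_nz dest: injD)
  have T_Suc: "T (Suc k) (h *v s) = T k s" for k s
    by (simp add: T_def inj flip: matrix_vector_mul_assoc vector_scalar_commute)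
  have H_inv: "H (h *v s) = H s" for s
  proof -
    \<comment> \<open>As \<open>K\<close> is a period, shifting the index only moves one term from
      the start to the end.\<close>
    have "T 0 (h *v s) = T K (h *v s)" by (simp add: T_def K)
    then have "H (h *v s) = (\<Sum>k<K. T (Suc k) (h *v s))"
      using sum.lessThan_Suc_shift[of "\<lambda>k. T k (h *v s)" K] sum.lessThan_Suc[of "\<lambda>k. T k (h *v s)" K]
      by (simp add: H_def)
    then show ?thesis by (simp add: T_Suc H_def)
  qed
  \<comment> \<open>This homogeneity absorbs the factor \<open>\<mu> d\<close> coming from the
    determinant and leaves only \<open>\<mu> a\<close>.\<close>
  have T_scale: "\<mu> d * T k (d *s s) = T k s" if "d \<noteq> 0" for d k s
  proof -
    have "\<mu> d * T k (d *s s) = (\<Sum>c\<in>UNIV - {0}. \<mu> (c * d) * of_bool (matpow h k *v r = (c * d) *s s))"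
      unfolding T_def sum_distrib_left
      by (intro sum.cong) (use that in \<open>auto simp: mu_mult vector_smult_assoc\<close>)
    also have "\<dots> = T k s" unfolding T_def
      by (rule sum.reindex_bij_witness[of _ "\<lambda>c. c / d" "\<lambda>c. c * d"]) (use that in auto)
    finally show ?thesis .
  qed
  have "f \<in> principal_series \<epsilon> m"
    unfolding principal_series_def mem_Collect_eq
  proof (intro conjI allI impI)
    fix a b d :: 'a and x :: "'a^2^2"
    assume ad: "a \<noteq> 0" "d \<noteq> 0" and x: "x \<in> GL2"
    let ?B = "vector [vector [a, b], vector [0, d]] :: 'a^2^2"
    have det_B: "det (?B ** x) = a * d * det x" unfolding det_mul by (simp add: det_2)
    have row: "(?B ** x) $ 2 = d *s (x $ 2)"
      by (simp add: vec_eq_iff matrix_matrix_mult_def sum_2)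
    have "f (?B ** x) = \<mu> a * \<mu> (det x) * (\<mu> d * H (d *s (x $ 2)))"
      using ad x by (simp add: f_def GL2_iff det_B row mu_mult)
    also have "\<mu> d * H (d *s (x $ 2)) = H (x $ 2)"
      by (simp add: H_def sum_distrib_left T_scale[OF ad(2)])
    finally show "f (?B ** x) = \<mu> a * f x" using x by (simp add: f_def)
  qed (simp add: f_def)
  moreover have "f (x ** g) = f x" for x
  proof -
    have "\<mu> (det g) = 1" using mu_eq_one_iff det det_g0 by blast
    then show ?thesis
      using det_g0 by (simp add: f_def GL2_iff det_mul mu_mult row_mult H_inv flip: h_def)
  qed
  moreover have "f \<noteq> 0"
  proof -
    obtain u where u: "bracket r u \<noteq> 0" using ex_bracket_nz r(1) by blast
    define x :: "'a^2^2" where "x = vector [u, r]"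
    have "det x = - bracket r u" by (simp add: x_def det_2 bracket_def algebra_simps)
    then have x: "x \<in> GL2" using u by (simp add: GL2_iff)
    \<comment> \<open>By the choice of \<open>r\<close> every weight that occurs is
      \<open>1\<close>, so \<open>H r\<close> is a natural number; \<open>k = 0\<close> and
      \<open>c = 1\<close> make it positive.\<close>
    have "T k r = of_nat (\<Sum>c\<in>UNIV - {0}. of_bool (matpow h k *v r = c *s r))" for k
      unfolding T_def of_nat_sum
      by (intro sum.cong) (use r(2) mu_eq_one_iff in auto)
    then have H: "H r = of_nat (\<Sum>k<K. \<Sum>c\<in>UNIV - {0}. of_bool (matpow h k *v r = c *s r))"
      by (simp add: H_def)
    have "(1 :: nat) \<le> (\<Sum>c\<in>UNIV - {0}. of_bool (matpow h 0 *v r = c *s r))"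
      using member_le_sum[of 1 "UNIV - {0}" "\<lambda>c. of_bool (matpow h 0 *v r = c *s r) :: nat"] by simp
    also have "\<dots> \<le> (\<Sum>k<K. \<Sum>c\<in>UNIV - {0}. of_bool (matpow h k *v r = c *s r))"
      by (rule member_le_sum[of 0]) (use K in auto)
    finally have "(\<Sum>k<K. \<Sum>c\<in>UNIV - {0}. of_bool (matpow h k *v r = c *s r)) \<noteq> (0 :: nat)"
      by linarith
    then have "H r \<noteq> 0" unfolding H of_nat_eq_0_iff .
    then have "f x \<noteq> 0" using x mu_nz by (simp add: f_def GL2_iff) (simp add: x_def)
    then show ?thesis by (auto simp: fun_eq_iff)
  qed
  ultimately show ?thesis using that by blast
qed

end

text \<open>The point masses span the space. Finiteness matters because an infinite basis would have
  \<open>card\<close> equal to \<open>0\<close>.\<close>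

lemma cfun_independent_finite:
  fixes B :: "('b::finite \<Rightarrow> complex) set"
  assumes "cfun.independent B"
  shows "finite B"
proof -
  define e where "e x = (\<lambda>y. of_bool (y = x) :: complex)" for x :: 'b
  have "f \<in> cfun.span (range e)" for f :: "'b \<Rightarrow> complex"
  proof -
    have "f = (\<Sum>x\<in>UNIV. cfun_scale (f x) (e x))"
    proof
      fix y
      have "(\<Sum>x\<in>A. cfun_scale (f x) (e x)) y = (\<Sum>x\<in>A. f x * e x y)" for A :: "'b set"
        by (induction A rule: infinite_finite_induct) (simp_all add: cfun_scale_def)
      then show "f y = (\<Sum>x\<in>UNIV. cfun_scale (f x) (e x)) y"
        by (simp add: e_def)
    qed
    then show ?thesis
      by (metis (no_types, lifting) cfun.span_base cfun.span_scale cfun.span_sum rangeI)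
  qed
  then show ?thesis using cfun.independent_span_bound[of "range e" B] assms
    by (meson finite finite_imageI subsetI)
qed

text \<open>Turns the intersection condition into the existence of one nonzero vector.\<close>

lemma cfun_dim_pos_iff:
  fixes W :: "('b::finite \<Rightarrow> complex) set"
  shows "1 \<le> cfun.dim W \<longleftrightarrow> (\<exists>f\<in>W. f \<noteq> 0)"
proof
  assume dim: "1 \<le> cfun.dim W"
  show "\<exists>f\<in>W. f \<noteq> 0"
  proof (rule ccontr)
    assume "\<not> (\<exists>f\<in>W. f \<noteq> 0)"
    then have "W \<subseteq> cfun.span {}" by auto
    then show False using cfun.dim_le_card[of W "{}"] dim by simp
  qed
next
  assume nz: "\<exists>f\<in>W. f \<noteq> 0"
  obtain B where B: "cfun.independent B" "W \<subseteq> cfun.span B" "card B = cfun.dim W"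
    using cfun.basis_exists by metis
  have "B \<noteq> {}" using nz B(2) by auto
  then show "1 \<le> cfun.dim W" using B cfun_independent_finite card_gt_0_iff by (metis Suc_leI One_nat_def)
qed

subsection \<open>Cross-intersecting pairs\<close>

context power_classes
begin

text \<open>Let \<open>g\<close> be the inverse of \<open>x\<close> times \<open>y\<close>. It has
  \<open>v\<close> as an eigenvector with eigenvalue of class \<open>a ^ m\<close>, and its
  determinant has the square of that class, so \<open>no_fixed_vector\<close> applies.\<close>

lemma eq_zero_if_fixed:
  assumes x: "x \<in> GL2 \<inter> det_class n" and y: "y \<in> GL2 \<inter> det_class n'" and n: "n \<in> N"
    and a: "a \<noteq> 0" "n' = (a ^ m)\<^sup>2 * n" "a ^ m \<noteq> 1"
    and v: "sim (x *v v) w" "sim (y *v v) (a *s w)"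
    and f: "f \<in> principal_series \<epsilon> m" "right_translation x f = right_translation y f"
  shows "f = 0"
proof -
  obtain x' where x': "x ** x' = mat 1" "x' ** x = mat 1"
    using x by (auto simp: GL2_def invertible_def)
  define g where "g = x' ** y"
  have "sim (y *v v) (a *s (x *v v))"
    using sim_trans[OF v(2) sim_scale[OF sim_sym[OF v(1)] a(1) refl]] .
  then obtain k where k: "k ^ m = 1" "y *v v = k *s (a *s (x *v v))" by (auto simp: sim_def)
  have "g *v v = x' *v (k *s (a *s (x *v v)))"
    by (simp add: g_def k(2) flip: matrix_vector_mul_assoc)
  also have "\<dots> = (k * a) *s ((x' ** x) *v v)"
    by (simp only: vector_scalar_commute vector_smult_assoc matrix_vector_mul_assoc)
  finally have gv: "g *v v = (k * a) *s v" by (simp add: x')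
  have ka: "(k * a) ^ m = a ^ m" "k * a \<noteq> 0"
    using k(1) a(1) by (auto simp: power_mult_distrib)
  have "x ** g = y" by (simp add: g_def matrix_mul_assoc x')
  then have "det x * det g = det y" by (metis det_mul)
  then have "det x ^ m * det g ^ m = det y ^ m" by (simp flip: power_mult_distrib)
  then have "n * det g ^ m = n * (a ^ m)\<^sup>2"
    using x y a(2) by (simp add: det_class_def mult.commute)
  then have det: "det g ^ m = ((k * a) ^ m)\<^sup>2" using N_nz[OF n] ka by simp
  have "v \<noteq> 0" using sim_nz(1)[OF v(1)] by auto
  moreover have "f (z ** g) = f z" for z
    using fun_cong[OF f(2), of "z ** x'"]
    by (simp add: right_translation_def g_def x' flip: matrix_mul_assoc)
  ultimately show ?thesis
    using no_fixed_vector[OF _ gv ka(2) det _ f(1)] ka a(3) by simp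
qed

lemma GL2_eq_det_classes: "GL2 = (\<Union>n\<in>N. det_class n)"
  using power_in_N_iff by (auto simp: GL2_def invertible_det_nz det_class_def)

lemma card_eq_sum_det_classes:
  assumes "S \<subseteq> GL2"
  shows "card S = (\<Sum>n\<in>N. card (S \<inter> det_class n))"
proof -
  have "S = (\<Union>n\<in>N. S \<inter> det_class n)" using assms GL2_eq_det_classes by auto
  then have "card S = card (\<Union>n\<in>N. S \<inter> det_class n)" by simp
  also have "\<dots> = (\<Sum>n\<in>N. card (S \<inter> det_class n))"
    by (rule card_UN_disjoint) (auto simp: det_class_def)
  finally show ?thesis .
qed

lemma card_GL2: "card (GL2 :: ('a^2^2) set) = l * class_size"
proof -
  have "GL2 \<inter> det_class n = det_class n" if "n \<in> N" for n
    using that GL2_eq_det_classes by auto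
  then have "card (GL2 :: ('a^2^2) set) = (\<Sum>n\<in>N. class_size)"
    using card_eq_sum_det_classes[of GL2] card_det_class by simp
  then show ?thesis by (simp add: card_N)
qed

text \<open>For distinct classes, \<open>eq_zero_if_fixed\<close> supplies the disjointness that
  \<open>mixing\<close> asks for; \<open>sum_mult_sum_le_one\<close> then adds up the
  densities.\<close>

lemma card_mult_le:
  assumes cross: "cross_intersecting \<epsilon> m 1 S1 S2"
  shows "real (card S1) * real (card S2) \<le> (real class_size)\<^sup>2"
proof -
  have sub: "S1 \<subseteq> GL2" "S2 \<subseteq> GL2" using cross by (auto simp: cross_intersecting_def)
  have l2: "l \<ge> 2" using prime_l prime_ge_2_nat by blast
  have "(\<Sum>n\<in>N. density S1 n) * (\<Sum>n\<in>N. density S2 n) \<le> 1"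
  proof (rule sum_mult_sum_le_one)
    show "finite N" "2 \<le> card N" using l2 card_N by simp_all
    fix n n' assume n: "n \<in> N" "n' \<in> N" "n \<noteq> n'"
    \<comment> \<open>The class of \<open>a\<close> is the square root of \<open>n' / n\<close> in
      \<open>N\<close>; it is nontrivial because \<open>n\<close> and \<open>n'\<close>
      differ.\<close>
    obtain a where a: "a \<noteq> 0" "(a ^ m)\<^sup>2 = n' / n" 
      using N_square_root[OF N_divide[OF n(2,1)]] by blast
    then have a': "n' = (a ^ m)\<^sup>2 * n" using N_nz[OF n(1)] by simp
    then have a'': "a ^ m \<noteq> 1" using n(3) by auto
    have "(real q + 1) * (density S1 n * density S2 n') \<le>
      2 * (sqrt (density S1 n * (1 - density S1 n)) * sqrt (density S2 n' * (1 - density S2 n')))"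
    proof (rule mixing[OF n(1,2) a(1)])
      fix x y v w
      assume x: "x \<in> S1 \<inter> det_class n" and y: "y \<in> S2 \<inter> det_class n'"
        and v: "sim (x *v v) w" "sim (y *v v) (a *s w)"
      obtain f where "f \<in> principal_series \<epsilon> m" "right_translation x f = right_translation y f" "f \<noteq> 0"
        using cross x y unfolding cross_intersecting_def cfun_dim_pos_iff by blast
      then show False using eq_zero_if_fixed[OF _ _ n(1) a(1) a' a'' v, of f] x y sub by blast
    qed
    \<comment> \<open>From \<open>m \<ge> 2\<close> follows \<open>2 * l < q\<close>, which is more
      than enough here.\<close>
    moreover have "2 * (real (card N) - 1) \<le> real q + 1"
    proof -
      have "l * 2 \<le> l * m" by (intro mult_left_mono m_ge_2) simp
      then have "real (l * 2) \<le> real q" using q_eq by (simp only: of_nat_le_iff)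
      then show ?thesis by (simp add: card_N)
    qed
    then have "2 * (real (card N) - 1) * (density S1 n * density S2 n') \<le>
        (real q + 1) * (density S1 n * density S2 n')"
      using density_bounds n by (intro mult_right_mono) auto
    ultimately show "(real (card N) - 1) * (density S1 n * density S2 n') \<le>
        sqrt (density S1 n * (1 - density S1 n)) * sqrt (density S2 n' * (1 - density S2 n'))"
      by linarith
  qed (simp_all add: density_bounds)
  moreover have "(\<Sum>n\<in>N. density S n) = card S / class_size" if "S \<subseteq> GL2" for S
    by (simp add: density_def card_eq_sum_det_classes[OF that] flip: sum_divide_distrib)
  ultimately show ?thesis
    using sub class_size_pos by (simp add: power2_eq_square divide_simps)
qed

text \<open>Quotients of members have determinant class \<open>1\<close>, so
  \<open>ex_fixed_vector\<close> provides the common vector. This pair attains the maximum.\<close>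

lemma cross_intersecting_det_class_one: "cross_intersecting \<epsilon> m 1 (det_class 1) (det_class 1)"
proof -
  have sub: "det_class 1 \<subseteq> GL2" using GL2_eq_det_classes one_in_N by auto
  have "\<exists>f\<in>{v \<in> principal_series \<epsilon> m. right_translation x v = right_translation y v}. f \<noteq> 0"
    if x: "x \<in> det_class 1" and y: "y \<in> det_class 1" for x y
  proof -
    obtain x' where x': "x ** x' = mat 1" "x' ** x = mat 1"
      using x sub by (auto simp: GL2_def invertible_def)
    have "x ** (x' ** y) = y" by (simp add: matrix_mul_assoc x')
    then have "det x * det (x' ** y) = det y" by (metis det_mul)
    then have "det (x' ** y) ^ m = 1"
      using x y by (auto simp: det_class_def power_mult_distrib dest: arg_cong[of _ _ "\<lambda>c. c ^ m"])
    then obtain f where f: "f \<in> principal_series \<epsilon> m" "f \<noteq> 0" "\<And>z. f (z ** (x' ** y)) = f z"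
      using ex_fixed_vector by blast
    have "f (z ** x) = f (z ** y)" for z
      using f(3)[of "z ** x"] \<open>x ** (x' ** y) = y\<close> by (metis matrix_mul_assoc)
    then show ?thesis using f(1,2) by (auto simp: right_translation_def)
  qed
  then show ?thesis unfolding cross_intersecting_def cfun_dim_pos_iff using sub by blast
qed

end

theorem theorem1p1:
  fixes \<epsilon> :: "'a::{field, finite}" and q l m :: nat
  assumes "q = CARD('a)" and "odd q"
    and "q - 1 = l * m"
    and "prime l" and "odd l" and "\<not> l dvd m"
    and "is_generator \<epsilon>"
  shows "Max {sqrt (real (card S1) * real (card S2)) | S1 S2. cross_intersecting \<epsilon> m 1 S1 S2}
           = real (card (GL2 :: ('a^2^2) set)) / real l"
proof -
  interpret power_classes \<epsilon> q l m
    using assms by unfold_locales auto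
  have "l > 0" using prime_l prime_gt_0_nat by blast
  \<comment> \<open>The \<open>l\<close> determinant classes have equal size, so the claimed maximum
    is the size of one of them.\<close>
  then have card: "real (card (GL2 :: ('a^2^2) set)) / real l = class_size"
    by (simp add: card_GL2)
  show ?thesis
    unfolding card
  proof (rule Max_eqI)
    have "{sqrt (real (card S1) * real (card S2)) | S1 S2. cross_intersecting \<epsilon> m 1 S1 S2} \<subseteq>
        (\<lambda>(S1 :: ('a^2^2) set, S2 :: ('a^2^2) set). sqrt (real (card S1) * real (card S2))) ` UNIV"
      by auto
    then show "finite {sqrt (real (card S1) * real (card S2)) | S1 S2. cross_intersecting \<epsilon> m 1 S1 S2}"
      by (rule finite_subset) simp
  next
    fix y assume "y \<in> {sqrt (real (card S1) * real (card S2)) | S1 S2. cross_intersecting \<epsilon> m 1 S1 S2}"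
    then show "y \<le> real class_size" using card_mult_le by (auto intro: real_le_lsqrt)
  next
    have "real class_size = sqrt (real (card (det_class 1)) * real (card (det_class 1)))"
      using card_det_class[OF one_in_N] by simp
    then show "real class_size \<in>
        {sqrt (real (card S1) * real (card S2)) | S1 S2. cross_intersecting \<epsilon> m 1 S1 S2}"
      using cross_intersecting_det_class_one by blast
  qed
qed

end
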